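(* Let $D$ be an integer-valued random variable with $d_{\min}:=\min\operatorname{supp}(D)\ge2$, and let $\varrho\in(0,\infty)$. If $$\varrho\ \ge\ \frac{1}{(d_{\min}-1)\log(d_{\min}+1)},$$ then $\widetilde\chi(\varrho)=\chi_{\mathcal T_{d_{\min}}}(\varrho)$, where $\mathcal T_{d}$ denotes the infinite homogeneous tree in which every vertex has degree $d$.
   Context: For a graph $G=(V,E)$ let $\mathcal P(V)$ be the set of probability measures on $V$ and, for $p\in\mathcal P(V)$, $$I_E(p)=\sum_{\{x,y\}\in E}\Big(\sqrt{\tfrac{p(x)}{\deg(x)}}-\sqrt{\tfrac{p(y)}{\deg(y)}}\Big)^2,\qquad J_V(p)=-\sum_{x\in V}p(x)\log p(x),$$ with $\deg$ the degree in $G$ and $0\log0=0$. Set $\chi_G(\varrho)=\inf_{p\in\mathcal P(V)}[I_E(p)+\varrho J_V(p)]$ and $$\widetilde\chi(\varrho)=\inf\{\chi_T(\varrho):\ T\text{ is an infinite tree with all degrees in }\operatorname{supp}(D)\}.$$ *)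

theory Defs
  imports "HOL-Probability.Probability"
begin

section \<open>Graphs, trees and degrees\<close>

definition simple_graph :: "'a set \<Rightarrow> 'a set set \<Rightarrow> bool" where
  "simple_graph V E \<longleftrightarrow> (\<forall>e\<in>E. \<exists>x\<in>V. \<exists>y\<in>V. x \<noteq> y \<and> e = {x, y})"

definition neighbours :: "'a set set \<Rightarrow> 'a \<Rightarrow> 'a set" where
  "neighbours E x = {y. {x, y} \<in> E}"

text \<open>By the convention for \<^const>\<open>card\<close>, the value is 0 at a vertex with infinitely many
  neighbours; \<open>infinite_tree_with_degrees\<close> below excludes such vertices.\<close>
definition graph_degree :: "'a set set \<Rightarrow> 'a \<Rightarrow> nat" where
  "graph_degree E x = card (neighbours E x)"

definition connected_graph :: "'a set \<Rightarrow> 'a set set \<Rightarrow> bool" where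
  "connected_graph V E \<longleftrightarrow> V \<noteq> {} \<and> (\<forall>x\<in>V. \<forall>y\<in>V. (x, y) \<in> {(u, v). {u, v} \<in> E}\<^sup>*)"

definition graph_cycle :: "'a set set \<Rightarrow> 'a list \<Rightarrow> bool" where
  "graph_cycle E xs \<longleftrightarrow> length xs \<ge> 3 \<and> distinct xs \<and>
     successively (\<lambda>u v. {u, v} \<in> E) xs \<and> {last xs, hd xs} \<in> E"

definition is_tree :: "'a set \<Rightarrow> 'a set set \<Rightarrow> bool" where
  "is_tree V E \<longleftrightarrow> simple_graph V E \<and> connected_graph V E \<and> (\<nexists>xs. graph_cycle E xs)"

definition infinite_tree_with_degrees :: "int set \<Rightarrow> 'a set \<Rightarrow> 'a set set \<Rightarrow> bool" where
  "infinite_tree_with_degrees S V E \<longleftrightarrow> is_tree V E \<and> infinite V \<and>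
     (\<forall>x\<in>V. finite (neighbours E x) \<and> int (graph_degree E x) \<in> S)"


section \<open>The functionals\<close>

text \<open>Over an edge \<open>e = {x, y}\<close> the double sum counts the two orders \<open>(x, y)\<close> and \<open>(y, x)\<close>,
  whence the factor one half; see \<open>edge_energy_doubleton\<close>.\<close>
definition edge_energy :: "'a set set \<Rightarrow> 'a pmf \<Rightarrow> 'a set \<Rightarrow> real" where
  "edge_energy E p e =
     (\<Sum>x\<in>e. \<Sum>y\<in>e. (sqrt (pmf p x / graph_degree E x) - sqrt (pmf p y / graph_degree E y))\<^sup>2) / 2"

lemma edge_energy_doubleton:
  "x \<noteq> y \<Longrightarrow> edge_energy E p {x, y} =
     (sqrt (pmf p x / graph_degree E x) - sqrt (pmf p y / graph_degree E y))\<^sup>2"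
  by (simp add: edge_energy_def power2_commute[of "sqrt (pmf p y / _)"])

text \<open>All summands below are nonnegative. The sums are taken in \<^typ>\<open>ennreal\<close> because the entropy
  of a measure with infinite support may be \<open>\<infinity>\<close>, whereas a divergent real \<^const>\<open>infsum\<close> would be 0.\<close>

definition I_energy :: "'a set set \<Rightarrow> 'a pmf \<Rightarrow> ennreal" where
  "I_energy E p = (\<Sum>\<^sub>\<infinity>e\<in>E. ennreal (edge_energy E p e))"

definition J_entropy :: "'a set \<Rightarrow> 'a pmf \<Rightarrow> ennreal" where
  "J_entropy V p = (\<Sum>\<^sub>\<infinity>x\<in>V. ennreal (- (pmf p x * ln (pmf p x))))"

definition chi :: "'a set \<Rightarrow> 'a set set \<Rightarrow> real \<Rightarrow> ennreal" where
  "chi V E \<rho> = (INF p \<in> {p. set_pmf p \<subseteq> V}. I_energy E p + ennreal \<rho> * J_entropy V p)"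

text \<open>A connected graph with finite degrees is countable, so it is no restriction to take the
  vertices of the competing trees from \<^typ>\<open>nat\<close>; see \<open>chi_tilde_le\<close>.\<close>
definition chi_tilde :: "int set \<Rightarrow> real \<Rightarrow> ennreal" where
  "chi_tilde S \<rho> =
     (INF (V, E) \<in> {(V :: nat set, E). infinite_tree_with_degrees S V E}. chi V E \<rho>)"

definition discrete_supp :: "'w measure \<Rightarrow> ('w \<Rightarrow> int) \<Rightarrow> int set" where
  "discrete_supp M D = {k. measure M {\<omega> \<in> space M. D \<omega> = k} > 0}"


section \<open>The homogeneous tree\<close>

text \<open>A vertex is its path from the root \<open>[]\<close>: the root has \<open>d\<close> children, every other vertex has
  \<open>d - 1\<close> children and one parent.\<close>

definition hom_tree_verts :: "nat \<Rightarrow> nat list set" where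
  "hom_tree_verts d = {xs. \<forall>j < length xs. xs ! j < (if j = 0 then d else d - 1)}"

definition hom_tree_edges :: "nat \<Rightarrow> nat list set set" where
  "hom_tree_edges d = {{xs, xs @ [i]} | xs i. xs @ [i] \<in> hom_tree_verts d}"

lemma hom_tree_verts_snoc:
  "xs @ [i] \<in> hom_tree_verts d \<longleftrightarrow>
     xs \<in> hom_tree_verts d \<and> i < (if xs = [] then d else d - 1)"
proof -
  have "(\<forall>j < length (xs @ [i]). (xs @ [i]) ! j < b j) \<longleftrightarrow>
      (\<forall>j < length xs. xs ! j < b j) \<and> i < b (length xs)" for b :: "nat \<Rightarrow> nat"
    by (auto simp: nth_append less_Suc_eq)
  then show ?thesis by (simp add: hom_tree_verts_def)
qed

lemma Nil_in_hom_tree_verts: "[] \<in> hom_tree_verts d"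
  by (simp add: hom_tree_verts_def)

lemma hom_tree_edge_iff:
  "{u, v} \<in> hom_tree_edges d \<longleftrightarrow>
     (u \<in> hom_tree_verts d \<and> u \<noteq> [] \<and> v = butlast u) \<or>
     (v \<in> hom_tree_verts d \<and> v \<noteq> [] \<and> u = butlast v)"
  (is "?L \<longleftrightarrow> ?R")
proof
  assume ?L
  then show ?R by (auto simp: hom_tree_edges_def doubleton_eq_iff)
next
  assume ?R
  moreover have "{butlast w, w} \<in> hom_tree_edges d" if "w \<in> hom_tree_verts d" "w \<noteq> []" for w
    using that unfolding hom_tree_edges_def
    by (intro CollectI exI[of _ "butlast w"] exI[of _ "last w"]) auto
  ultimately show ?L by (metis insert_commute)
qed

lemma neighbours_hom_tree:
  assumes "xs \<in> hom_tree_verts d"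
  shows "neighbours (hom_tree_edges d) xs =
    (if xs = [] then (\<lambda>i. [i]) ` {..<d}
     else insert (butlast xs) ((\<lambda>i. xs @ [i]) ` {..<d - 1}))"
proof -
  have *: "(y \<in> hom_tree_verts d \<and> y \<noteq> [] \<and> xs = butlast y) \<longleftrightarrow>
      (\<exists>i < (if xs = [] then d else d - 1). y = xs @ [i])" for y
    using assms hom_tree_verts_snoc[of "butlast y" "last y" d]
    by (cases y rule: rev_cases) (auto simp: hom_tree_verts_snoc)
  show ?thesis
    unfolding neighbours_def hom_tree_edge_iff * using assms by (auto split: if_splits)
qed

lemma degree_hom_tree:
  assumes "xs \<in> hom_tree_verts d" "d \<ge> 1"
  shows "finite (neighbours (hom_tree_edges d) xs)" "graph_degree (hom_tree_edges d) xs = d"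
proof -
  show "finite (neighbours (hom_tree_edges d) xs)"
    using neighbours_hom_tree[OF assms(1)] by simp
  have "butlast xs \<notin> (\<lambda>i. xs @ [i]) ` {..<d - 1}" if "xs \<noteq> []"
  proof
    assume "butlast xs \<in> (\<lambda>i. xs @ [i]) ` {..<d - 1}"
    then obtain i where "butlast xs = xs @ [i]" by auto
    then have "length (butlast xs) = length (xs @ [i])" by simp
    then show False by simp
  qed
  then show "graph_degree (hom_tree_edges d) xs = d"
    using neighbours_hom_tree[OF assms(1)] assms(2)
    by (auto simp: graph_degree_def card_image inj_on_def card_insert_if)
qed

lemma hom_tree_no_cycle: "\<not> graph_cycle (hom_tree_edges d) xs"
proof
  let ?E = "hom_tree_edges d" and ?n = "length xs"
  assume c: "graph_cycle ?E xs"
  then have n: "?n \<ge> 3" and dist: "distinct xs" by (auto simp: graph_cycle_def)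
  have xs_ne: "xs \<noteq> []" using n by (cases xs) auto
  have adj: "{xs ! i, xs ! (Suc i mod ?n)} \<in> ?E" if "i < ?n" for i
  proof (cases "Suc i < ?n")
    case True
    then show ?thesis using c by (auto simp: graph_cycle_def successively_conv_nth)
  next
    case False
    then have "i = ?n - 1" using that by simp
    then show ?thesis using c xs_ne
      by (auto simp: graph_cycle_def last_conv_nth hd_conv_nth)
  qed
  \<comment> \<open>Both neighbours on the cycle of a vertex of maximal depth are its parent.\<close>
  obtain k where k: "k < ?n" and kmax: "\<And>i. i < ?n \<Longrightarrow> length (xs ! i) \<le> length (xs ! k)"
  proof -
    have "\<forall>i. i < ?n \<longrightarrow> length (xs ! i) < Suc (\<Sum>j<?n. length (xs ! j))"
      by (auto intro!: member_le_sum le_imp_less_Suc)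
    moreover have "0 < ?n" using xs_ne by simp
    ultimately have "\<exists>k. k < ?n \<and> (\<forall>i. i < ?n \<longrightarrow> length (xs ! i) \<le> length (xs ! k))"
      by (intro ex_has_greatest_nat)
    then show ?thesis using that by auto
  qed
  have parent: "xs ! i = butlast (xs ! k)" if "{xs ! k, xs ! i} \<in> ?E" "i < ?n" for i
  proof -
    have False if "xs ! i \<noteq> []" "xs ! k = butlast (xs ! i)"
      using kmax[OF \<open>i < ?n\<close>] that by (cases "xs ! i" rule: rev_cases) auto
    then show ?thesis using that by (auto simp: hom_tree_edge_iff)
  qed
  define s where "s = (if Suc k = ?n then 0 else Suc k)"
  define q where "q = (if k = 0 then ?n - 1 else k - 1)"
  have sq: "s < ?n" "q < ?n" "s \<noteq> q" using n k by (auto simp: s_def q_def split: if_splits)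
  have "Suc k mod ?n = s" "Suc q mod ?n = k" using n k by (auto simp: s_def q_def)
  then have "{xs ! k, xs ! s} \<in> ?E" "{xs ! k, xs ! q} \<in> ?E"
    using adj[OF k] adj[OF sq(2)] by (simp_all add: insert_commute)
  then have "xs ! s = xs ! q" using parent[of s] parent[of q] sq(1,2) by metis
  then show False using dist sq by (simp add: nth_eq_iff_index_eq)
qed

lemma is_tree_hom_tree: "is_tree (hom_tree_verts d) (hom_tree_edges d)"
proof -
  let ?V = "hom_tree_verts d" and ?E = "hom_tree_edges d"
  let ?R = "{(u, v). {u, v} \<in> ?E}"
  have "simple_graph ?V ?E"
    unfolding simple_graph_def
  proof
    fix e assume "e \<in> ?E"
    then obtain xs i where e: "e = {xs, xs @ [i]}" "xs @ [i] \<in> ?V"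
      unfolding hom_tree_edges_def by blast
    then have "xs \<in> ?V" by (simp add: hom_tree_verts_snoc)
    then show "\<exists>x\<in>?V. \<exists>y\<in>?V. x \<noteq> y \<and> e = {x, y}"
      by (rule bexI[of _ xs, rotated]) (rule bexI[of _ "xs @ [i]"], simp_all add: e)
  qed
  moreover have root: "([], xs) \<in> ?R\<^sup>*" if "xs \<in> ?V" for xs
    using that
  proof (induction xs rule: rev_induct)
    case (snoc i xs)
    then have "([], xs) \<in> ?R\<^sup>*" by (simp add: hom_tree_verts_snoc)
    moreover have "(xs, xs @ [i]) \<in> ?R" using snoc.prems by (simp add: hom_tree_edge_iff)
    ultimately show ?case by (rule rtrancl_into_rtrancl)
  qed auto
  have sym: "sym (?R\<^sup>*)"
  proof (rule sym_rtrancl)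
    show "sym ?R" by (rule symI) (simp add: insert_commute)
  qed
  have "connected_graph ?V ?E"
    unfolding connected_graph_def
  proof (intro conjI ballI)
    show "?V \<noteq> {}" using Nil_in_hom_tree_verts[of d] by auto
    fix x y assume "x \<in> ?V" "y \<in> ?V"
    then show "(x, y) \<in> ?R\<^sup>*" using rtrancl_trans[OF symD[OF sym root] root] by simp
  qed
  ultimately show ?thesis unfolding is_tree_def using hom_tree_no_cycle by blast
qed

theorem hom_tree_homogeneous:
  assumes "d \<ge> 2"
  shows "infinite_tree_with_degrees {int d} (hom_tree_verts d) (hom_tree_edges d)"
proof -
  have "replicate n 0 \<in> hom_tree_verts d" for n
    using assms by (auto simp: hom_tree_verts_def)
  then have "range (\<lambda>n. replicate n (0 :: nat)) \<subseteq> hom_tree_verts d" by auto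
  moreover have "inj (\<lambda>n. replicate n (0 :: nat))"
    by (intro injI) (metis length_replicate)
  ultimately have "infinite (hom_tree_verts d)"
    using infinite_super range_inj_infinite by blast
  then show ?thesis using assms is_tree_hom_tree degree_hom_tree
    by (auto simp: infinite_tree_with_degrees_def)
qed


section \<open>The vertex type of the competing trees\<close>

lemma simple_graph_edgeD:
  assumes "simple_graph V E" "{x, y} \<in> E"
  shows "x \<in> V" "y \<in> V" "x \<noteq> y"
  using assms unfolding simple_graph_def by (force simp: doubleton_eq_iff)+

lemma countable_connected_graph:
  assumes "simple_graph V E" "connected_graph V E" "\<And>x. x \<in> V \<Longrightarrow> finite (neighbours E x)"
  shows "countable V"
proof -
  let ?R = "{(u, v). {u, v} \<in> E}"
  obtain x0 where x0: "x0 \<in> V" using assms(2) by (auto simp: connected_graph_def)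
  have fin: "finite (?R `` {x})" for x
  proof (cases "x \<in> V")
    case True
    then show ?thesis using assms(3)[of x] by (simp add: Image_def neighbours_def)
  next
    case False
    then have "?R `` {x} = {}" using simple_graph_edgeD(1)[OF assms(1)] by blast
    then show ?thesis by simp
  qed
  have "countable (?R `` Y)" if "countable Y" for Y
  proof -
    have "?R `` Y = (\<Union>x\<in>Y. ?R `` {x})" by blast
    then show ?thesis using that fin by (simp add: countable_finite)
  qed
  then have "countable (?R\<^sup>* `` {x0})" by (rule countable_rtrancl) simp_all
  moreover have "V \<subseteq> ?R\<^sup>* `` {x0}" using assms(2) x0 by (auto simp: connected_graph_def)
  ultimately show ?thesis by (rule countable_subset[rotated])
qed

context
  fixes V :: "'a set" and E :: "'a set set" and f :: "'a \<Rightarrow> 'b"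
  assumes simple: "simple_graph V E" and inj: "inj_on f V"
begin

lemma edge_subset: "e \<in> E \<Longrightarrow> e \<subseteq> V"
  using simple by (auto simp: simple_graph_def)

lemma edge_image_iff:
  assumes "x \<in> V" "y \<in> V"
  shows "{f x, f y} \<in> (`) f ` E \<longleftrightarrow> {x, y} \<in> E"
proof
  assume "{f x, f y} \<in> (`) f ` E"
  then obtain e where e: "e \<in> E" "f ` {x, y} = f ` e" by auto
  then have "{x, y} = e"
    using inj_on_image_eq_iff[OF inj, of "{x, y}" e] edge_subset assms by simp
  then show "{x, y} \<in> E" using e by simp
next
  assume "{x, y} \<in> E"
  then have "f ` {x, y} \<in> (`) f ` E" by (rule imageI)
  then show "{f x, f y} \<in> (`) f ` E" by simp
qed

lemma simple_graph_image: "simple_graph (f ` V) ((`) f ` E)"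
  unfolding simple_graph_def
proof
  fix e' assume "e' \<in> (`) f ` E"
  then obtain e where "e \<in> E" "e' = f ` e" by auto
  then obtain x y where "x \<in> V" "y \<in> V" "x \<noteq> y" "e' = {f x, f y}"
    using simple by (fastforce simp: simple_graph_def)
  then show "\<exists>x\<in>f ` V. \<exists>y\<in>f ` V. x \<noteq> y \<and> e' = {x, y}"
    using inj by (metis imageI inj_onD)
qed

lemma neighbours_image:
  assumes "x \<in> V"
  shows "neighbours ((`) f ` E) (f x) = f ` neighbours E x"
proof (intro equalityI subsetI)
  fix y' assume y': "y' \<in> neighbours ((`) f ` E) (f x)"
  then have "y' \<in> f ` V"
    using simple_graph_edgeD(2)[OF simple_graph_image] by (auto simp: neighbours_def)
  then show "y' \<in> f ` neighbours E x"
    using y' edge_image_iff[OF assms] by (auto simp: neighbours_def)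
next
  fix y' assume "y' \<in> f ` neighbours E x"
  then show "y' \<in> neighbours ((`) f ` E) (f x)"
    using edge_image_iff[OF assms] simple_graph_edgeD(2)[OF simple]
    by (auto simp: neighbours_def)
qed

lemma graph_degree_image:
  assumes "x \<in> V"
  shows "graph_degree ((`) f ` E) (f x) = graph_degree E x"
proof -
  have "neighbours E x \<subseteq> V" using simple_graph_edgeD(2)[OF simple] by (auto simp: neighbours_def)
  then show ?thesis
    unfolding graph_degree_def neighbours_image[OF assms]
    by (intro card_image inj_on_subset[OF inj])
qed

lemma connected_graph_image:
  assumes "connected_graph V E"
  shows "connected_graph (f ` V) ((`) f ` E)"
proof -
  have "(f x, f y) \<in> {(u, v). {u, v} \<in> (`) f ` E}\<^sup>*" if "(x, y) \<in> {(u, v). {u, v} \<in> E}\<^sup>*" for x y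
    using that
  proof (induction rule: rtrancl_induct)
    case (step y z)
    then have "(f y, f z) \<in> {(u, v). {u, v} \<in> (`) f ` E}"
      using edge_image_iff simple_graph_edgeD[OF simple] by simp
    with step.IH show ?case by (rule rtrancl_into_rtrancl)
  qed simp
  then show ?thesis using assms by (simp add: connected_graph_def)
qed

lemma graph_cycle_image:
  assumes "graph_cycle ((`) f ` E) ys"
  shows "\<exists>xs. graph_cycle E xs"
proof -
  let ?E' = "(`) f ` E"
  have suc: "{ys ! i, ys ! Suc i} \<in> ?E'" if "Suc i < length ys" for i
    using that assms by (simp add: graph_cycle_def successively_conv_nth)
  have len: "length ys \<ge> 3" and last: "{last ys, hd ys} \<in> ?E'" and dist: "distinct ys"
    using assms by (auto simp: graph_cycle_def)
  then have ne: "ys \<noteq> []" by (cases ys) auto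
  have "ys ! i \<in> f ` V" if "i < length ys" for i
  proof (cases "Suc i < length ys")
    case True
    then show ?thesis using suc simple_graph_edgeD(1)[OF simple_graph_image] by blast
  next
    case False
    then have "i = length ys - 1" using that by simp
    then have "ys ! i = last ys" using ne by (simp add: last_conv_nth)
    then show ?thesis using last simple_graph_edgeD(1)[OF simple_graph_image] by auto
  qed
  then have sub: "set ys \<subseteq> f ` V" by (auto simp: in_set_conv_nth)
  define xs where "xs = map (inv_into V f) ys"
  have "set xs \<subseteq> V" using sub by (auto simp: xs_def intro: inv_into_into)
  moreover have "ys = map f xs"
    using sub by (auto simp: xs_def f_inv_into_f subset_iff intro!: map_idI[symmetric])
  ultimately have xs: "set xs \<subseteq> V" "ys = map f xs" by auto
  have ne': "xs \<noteq> []" using ne xs(2) by simp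
  have V: "xs ! i \<in> V" if "i < length xs" for i using xs that by auto
  have "{xs ! i, xs ! Suc i} \<in> E" if "Suc i < length xs" for i
    using suc[of i] that V[of i] V[of "Suc i"] edge_image_iff xs(2) by simp
  moreover have "{last xs, hd xs} \<in> E"
  proof -
    have "last xs \<in> V" "hd xs \<in> V" using xs ne' by (auto dest: subsetD)
    then show ?thesis using last edge_image_iff xs(2) ne' by (simp add: last_map hd_map)
  qed
  moreover have "distinct xs" using dist xs by (simp add: distinct_map)
  ultimately have "graph_cycle E xs"
    using len xs(2) by (simp add: graph_cycle_def successively_conv_nth)
  then show ?thesis ..
qed

lemma infinite_tree_with_degrees_image:
  assumes "infinite_tree_with_degrees S V E"
  shows "infinite_tree_with_degrees S (f ` V) ((`) f ` E)"
proof -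
  have t: "connected_graph V E" "\<nexists>xs. graph_cycle E xs" "infinite V"
    and deg: "\<And>x. x \<in> V \<Longrightarrow> finite (neighbours E x) \<and> int (graph_degree E x) \<in> S"
    using assms by (simp_all add: infinite_tree_with_degrees_def is_tree_def)
  have "is_tree (f ` V) ((`) f ` E)"
    unfolding is_tree_def
    using simple_graph_image connected_graph_image[OF t(1)] graph_cycle_image t(2) by blast
  moreover have "infinite (f ` V)" using t(3) finite_image_iff[OF inj] by simp
  moreover have "finite (neighbours ((`) f ` E) (f x)) \<and> int (graph_degree ((`) f ` E) (f x)) \<in> S"
    if "x \<in> V" for x
    using deg[OF that] that by (simp add: graph_degree_image neighbours_image)
  ultimately show ?thesis by (simp add: infinite_tree_with_degrees_def)
qed

context
  fixes p :: "'a pmf"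
  assumes p: "set_pmf p \<subseteq> V"
begin

lemma pmf_map_image:
  assumes "x \<in> V"
  shows "pmf (map_pmf f p) (f x) = pmf p x"
proof (cases "x \<in> set_pmf p")
  case True
  then show ?thesis using pmf_map_inj[OF inj_on_subset[OF inj p]] by blast
next
  case False
  then have "f x \<notin> set_pmf (map_pmf f p)" using assms p inj by (auto dest: inj_onD)
  then show ?thesis using False by (simp only: set_pmf_iff not_not)
qed

lemma I_energy_image: "I_energy ((`) f ` E) (map_pmf f p) = I_energy E p"
proof -
  have "inj_on ((`) f) E"
    using inj_on_image_eq_iff[OF inj] edge_subset by (auto simp: inj_on_def)
  then have "I_energy ((`) f ` E) (map_pmf f p) =
      (\<Sum>\<^sub>\<infinity>e\<in>E. ennreal (edge_energy ((`) f ` E) (map_pmf f p) (f ` e)))"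
    unfolding I_energy_def by (simp add: infsum_reindex o_def)
  also have "\<dots> = I_energy E p"
    unfolding I_energy_def
  proof (rule infsum_cong)
    fix e assume "e \<in> E"
    then obtain x y where "x \<in> V" "y \<in> V" "x \<noteq> y" "e = {x, y}"
      using simple by (auto simp: simple_graph_def)
    moreover from this have "f x \<noteq> f y" using inj by (auto dest: inj_onD)
    ultimately show "ennreal (edge_energy ((`) f ` E) (map_pmf f p) (f ` e)) =
        ennreal (edge_energy E p e)"
      by (simp add: edge_energy_doubleton pmf_map_image graph_degree_image)
  qed
  finally show ?thesis .
qed

lemma J_entropy_image: "J_entropy (f ` V) (map_pmf f p) = J_entropy V p"
  unfolding J_entropy_def infsum_reindex[OF inj] o_def
  by (rule infsum_cong) (simp add: pmf_map_image)

end

lemma chi_image_le: "chi (f ` V) ((`) f ` E) \<rho> \<le> chi V E \<rho>"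
  unfolding chi_def
proof (rule INF_mono)
  fix p assume "p \<in> {p. set_pmf p \<subseteq> V}"
  then show "\<exists>q\<in>{q. set_pmf q \<subseteq> f ` V}.
      I_energy ((`) f ` E) q + ennreal \<rho> * J_entropy (f ` V) q
        \<le> I_energy E p + ennreal \<rho> * J_entropy V p"
    by (intro bexI[of _ "map_pmf f p"]) (auto simp: I_energy_image J_entropy_image)
qed

end

theorem chi_tilde_le:
  fixes V :: "'a set"
  assumes "infinite_tree_with_degrees S V E"
  shows "chi_tilde S \<rho> \<le> chi V E \<rho>"
proof -
  have simple: "simple_graph V E" and "countable V"
    using assms countable_connected_graph[of V E]
    by (auto simp: infinite_tree_with_degrees_def is_tree_def)
  define f where "f = to_nat_on V"
  have inj: "inj_on f V" using \<open>countable V\<close> unfolding f_def by (rule inj_on_to_nat_on)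
  have "chi_tilde S \<rho> \<le> chi (f ` V) ((`) f ` E) \<rho>"
    unfolding chi_tilde_def
    using infinite_tree_with_degrees_image[OF simple inj assms] by (auto intro: INF_lower2)
  also have "\<dots> \<le> chi V E \<rho>" by (rule chi_image_le[OF simple inj])
  finally show ?thesis .
qed

end

theory Submission
  imports Defs
begin

text \<open>Write \<open>p(x) = deg(x) g(x)\<^sup>2\<close> and \<open>c\<close> for the value on the \<open>d\<close>-regular tree. By Gibbs' inequality
  \<open>- ln p\<close> may replace the logarithm of any other competitor, so restricting \<open>g\<close> to a \<open>d\<close>-regular
  subtree \<open>S\<close> gives the linear inequality \<open>\<Sum>\<^bsub>x\<in>S\<^esub> d \<alpha>(x) \<ge> 2 \<Sum>\<^bsub>xy\<in>E(S)\<^esub> g(x) g(y)\<close> with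
  \<open>\<alpha> = g\<^sup>2 (1 - \<rho> ln p - c)\<close>. There is a measure on such subtrees for which those through a vertex
  \<open>x\<close> have mass \<open>deg(x)\<close> and those through an edge have mass \<open>d\<close>, and integrating against it yields
  \<open>\<Sum>\<^bsub>x\<^esub> deg(x) \<alpha>(x) \<ge> 2 \<Sum>\<^bsub>xy\<in>E\<^esub> g(x) g(y)\<close>, that is, \<open>I(p) + \<rho> J(p) \<ge> c\<close>. The integration is replaced by a greedy
  choice: root the tree, and from the leaves upwards keep the cheapest \<open>d - 1\<close> of the branches
  at every vertex (\<open>d\<close> if the vertex is to be the top of the subtree).\<close>

section \<open>Rooted trees\<close>

text \<open>Orienting the edges towards a root labels each edge by its lower end, so that sums over
  \<open>E\<close> become sums over \<open>V - {r}\<close>. The depth function takes the place of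
  acyclicity; the value \<open>par r\<close> is left unspecified.\<close>

locale rooted_tree =
  fixes V :: "'a set" and E :: "'a set set" and r :: 'a and par :: "'a \<Rightarrow> 'a" and dep :: "'a \<Rightarrow> nat"
  assumes root: "r \<in> V" "dep r = 0"
    and par: "x \<in> V - {r} \<Longrightarrow> par x \<in> V"
    and dep_par: "x \<in> V - {r} \<Longrightarrow> dep x = Suc (dep (par x))"
    and edges: "E = (\<lambda>x. {x, par x}) ` (V - {r})"
    and finite_neighbours: "x \<in> V \<Longrightarrow> finite (neighbours E x)"
begin

definition children :: "'a \<Rightarrow> 'a set" where
  "children x = {c \<in> V - {r}. par c = x}"

text \<open>The descendants of \<open>v\<close> at most \<open>n\<close> generations below it. The
  equation for \<open>dep\<close> keeps the iterates of \<open>par\<close> from passing the root,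
  where \<open>par\<close> is unspecified.\<close>

definition desc :: "nat \<Rightarrow> 'a \<Rightarrow> 'a set" where
  "desc n v = {x \<in> V. \<exists>k\<le>n. dep x = dep v + k \<and> (par ^^ k) x = v}"

lemma par_neq: "x \<in> V - {r} \<Longrightarrow> par x \<noteq> x"
  using dep_par by fastforce

text \<open>Two vertices cannot be parents of each other, because \<open>dep\<close> drops by one
  from a child to its parent.\<close>

lemma inj_on_edges: "inj_on (\<lambda>x. {x, par x}) (V - {r})"
proof (rule inj_onI)
  fix x y assume x: "x \<in> V - {r}" and y: "y \<in> V - {r}" and "{x, par x} = {y, par y}"
  then have "x = y \<or> x = par y \<and> y = par x" by (auto simp: doubleton_eq_iff)
  then show "x = y" using dep_par[OF x] dep_par[OF y] by auto
qed

lemma neighbours_eq: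
  assumes "x \<in> V"
  shows "neighbours E x = children x \<union> (if x = r then {} else {par x})"
proof -
  have "y \<in> neighbours E x \<longleftrightarrow> (y \<in> V - {r} \<and> par y = x) \<or> (x \<in> V - {r} \<and> y = par x)" for y
    unfolding neighbours_def edges by (auto simp: doubleton_eq_iff image_iff)
  then show ?thesis using assms by (auto simp: children_def)
qed

lemma finite_children: "x \<in> V \<Longrightarrow> finite (children x)"
  using finite_neighbours[of x] by (auto simp: neighbours_eq)

lemma degree_eq:
  assumes "x \<in> V"
  shows "graph_degree E x = card (children x) + (if x = r then 0 else 1)"
proof -
  have "par x \<notin> children x" if "x \<noteq> r"
    using that assms dep_par[of x] dep_par[of "par x"] by (auto simp: children_def)
  then show ?thesis
    unfolding graph_degree_def using neighbours_eq[OF assms] finite_children[OF assms] by auto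
qed

lemma childrenD: "c \<in> children v \<Longrightarrow> c \<in> V \<and> c \<noteq> r \<and> par c = v \<and> dep c = Suc (dep v)"
  using dep_par by (auto simp: children_def)

section \<open>Ancestors and descendants\<close>

lemma funpow_par:
  assumes "x \<in> V" "k \<le> dep x"
  shows "(par ^^ k) x \<in> V \<and> dep ((par ^^ k) x) = dep x - k"
  using assms(2)
proof (induction k)
  case (Suc k)
  then have "(par ^^ k) x \<in> V - {r}" using root(2) by force
  with par[OF this] dep_par[OF this] Suc show ?case by auto
qed (use assms in auto)

lemma in_desc_root: "x \<in> V \<Longrightarrow> dep x \<le> n \<Longrightarrow> x \<in> desc n r"
  using funpow_par[of x "dep x"] dep_par[of "(par ^^ dep x) x"] root(2)
  by (auto simp: desc_def intro!: exI[of _ "dep x"])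

lemma desc_0: "v \<in> V \<Longrightarrow> desc 0 v = {v}"
  by (auto simp: desc_def)

lemma desc_Suc:
  assumes "v \<in> V"
  shows "desc (Suc n) v = insert v (\<Union>c\<in>children v. desc n c)"
proof (intro equalityI subsetI)
  fix x assume "x \<in> desc (Suc n) v"
  then obtain k where k: "x \<in> V" "k \<le> Suc n" "dep x = dep v + k" "(par ^^ k) x = v"
    by (auto simp: desc_def)
  show "x \<in> insert v (\<Union>c\<in>children v. desc n c)"
  proof (cases k)
    case (Suc j)
    \<comment> \<open>The child of \<open>v\<close> on the path from \<open>x\<close> up to
      \<open>v\<close>.\<close>
    let ?c = "(par ^^ j) x"
    have c: "?c \<in> V" "dep ?c = Suc (dep v)" using funpow_par[of x j] k Suc by auto
    moreover have "?c \<noteq> r" using root(2) c by auto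
    ultimately have "?c \<in> children v" using k Suc by (auto simp: children_def)
    moreover have "x \<in> desc n ?c" using k Suc c by (auto simp: desc_def)
    ultimately show ?thesis by blast
  qed (use k in auto)
next
  fix x assume "x \<in> insert v (\<Union>c\<in>children v. desc n c)"
  then consider "x = v" | c where "c \<in> children v" "x \<in> desc n c" by blast
  then show "x \<in> desc (Suc n) v"
  proof cases
    case 2
    then obtain k where "x \<in> V" "k \<le> n" "dep x = dep c + k" "(par ^^ k) x = c"
      by (auto simp: desc_def)
    then show ?thesis using childrenD[OF 2(1)]
      by (auto simp: desc_def intro!: exI[of _ "Suc k"])
  qed (use assms in \<open>auto simp: desc_def\<close>)
qed

lemma dep_desc: "x \<in> desc n v \<Longrightarrow> dep v \<le> dep x"
  by (auto simp: desc_def)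

lemma desc_ancestor: "x \<in> desc n v \<Longrightarrow> (par ^^ (dep x - dep v)) x = v"
  by (auto simp: desc_def)

text \<open>A descendant determines the child of \<open>v\<close> above it, as its ancestor of depth
  \<open>Suc (dep v)\<close>.\<close>

lemma desc_disjoint:
  assumes "c \<in> children v" "c' \<in> children v" "c \<noteq> c'"
  shows "desc n c \<inter> desc n c' = {}"
  using desc_ancestor[of _ n c] desc_ancestor[of _ n c'] assms childrenD[of c v] childrenD[of c' v]
  by fastforce

lemma finite_desc: "v \<in> V \<Longrightarrow> finite (desc n v)"
  by (induction n arbitrary: v) (auto simp: desc_0 desc_Suc finite_children dest: childrenD)

text \<open>Serves twice: for selected branches below some of the children, and with
  \<open>B c = desc n c\<close> for the recursion of \<open>desc\<close> itself.\<close>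

lemma sum_children_union:
  fixes w :: "'a \<Rightarrow> real"
  assumes "v \<in> V" "C \<subseteq> children v" "\<And>c. c \<in> C \<Longrightarrow> B c \<subseteq> desc n c"
  shows "sum w (insert v (\<Union>c\<in>C. B c)) = w v + (\<Sum>c\<in>C. sum w (B c))"
proof -
  have fin: "finite C" using assms finite_children finite_subset by blast
  have finB: "finite (B c)" if "c \<in> C" for c
    using assms that finite_desc[of c n] childrenD[of c v] finite_subset by blast
  have "v \<notin> (\<Union>c\<in>C. B c)"
    using assms dep_desc[of v n] childrenD[of _ v] by fastforce
  moreover have "sum w (\<Union>c\<in>C. B c) = (\<Sum>c\<in>C. sum w (B c))"
    using desc_disjoint[of _ v _ n] assms finB fin by (intro sum.UNION_disjoint) blast+
  ultimately show ?thesis using fin finB by simp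
qed

section \<open>The energy as a sum over vertices\<close>

text \<open>\<open>W\<close> labels the edges with an end in \<open>A\<close>, outside which
  \<open>h\<close> vanishes. After expansion, the square of \<open>h x\<close> occurs once for each
  edge at \<open>x\<close>: the edge to its parent, unless \<open>x = r\<close>, and the edges to
  its children. The product \<open>h x * h (par x)\<close> vanishes unless \<open>x\<close> lies in
  \<open>A\<close>.\<close>

lemma sum_square_differences:
  fixes h :: "'a \<Rightarrow> real"
  assumes A: "finite A" "A \<subseteq> V" and h: "\<forall>x\<in>V - A. h x = 0"
  defines "W \<equiv> {x \<in> V - {r}. x \<in> A \<or> par x \<in> A}"
  shows "finite W"
    and "\<And>x. x \<in> V - {r} - W \<Longrightarrow> h x = 0 \<and> h (par x) = 0"
    and "(\<Sum>x\<in>W. (h x - h (par x))\<^sup>2) =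
      (\<Sum>x\<in>A. real (graph_degree E x) * (h x)\<^sup>2) - 2 * (\<Sum>x\<in>A - {r}. h x * h (par x))"
proof -
  have W: "W = (A - {r}) \<union> (\<Union>y\<in>A. children y)"
    using A by (auto simp: W_def children_def)
  show fin: "finite W" unfolding W using A finite_children by (auto dest: subsetD)
  show "\<And>x. x \<in> V - {r} - W \<Longrightarrow> h x = 0 \<and> h (par x) = 0"
    using h par by (auto simp: W_def)
  have "(\<Sum>x\<in>W. (h x - h (par x))\<^sup>2) =
      (\<Sum>x\<in>W. (h x)\<^sup>2) + (\<Sum>x\<in>W. (h (par x))\<^sup>2) - 2 * (\<Sum>x\<in>W. h x * h (par x))"
    by (simp add: power2_diff sum.distrib sum_subtractf sum_distrib_left algebra_simps)
  also have "(\<Sum>x\<in>W. (h x)\<^sup>2) = (\<Sum>x\<in>A - {r}. (h x)\<^sup>2)"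
    using fin h A(2) by (intro sum.mono_neutral_right) (auto simp: W_def W)
  also have "(\<Sum>x\<in>W. h x * h (par x)) = (\<Sum>x\<in>A - {r}. h x * h (par x))"
    using fin h A(2) by (intro sum.mono_neutral_right) (auto simp: W_def W)
  also have "(\<Sum>x\<in>W. (h (par x))\<^sup>2) = (\<Sum>x\<in>(\<Union>y\<in>A. children y). (h (par x))\<^sup>2)"
    using fin h par A by (intro sum.mono_neutral_right) (auto simp: W_def W children_def)
  also have "\<dots> = (\<Sum>y\<in>A. \<Sum>x\<in>children y. (h (par x))\<^sup>2)"
    using A finite_children by (intro sum.UNION_disjoint) (auto simp: children_def)
  also have "\<dots> = (\<Sum>y\<in>A. real (card (children y)) * (h y)\<^sup>2)"
    by (intro sum.cong refl) (simp add: children_def)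
  also have "(\<Sum>x\<in>A - {r}. (h x)\<^sup>2) = (\<Sum>x\<in>A. (if x = r then 0 else 1) * (h x)\<^sup>2)"
    using A by (intro sum.mono_neutral_cong_left) auto
  finally have "(\<Sum>x\<in>W. (h x - h (par x))\<^sup>2) =
      (\<Sum>x\<in>A. ((if x = r then 0 else 1) + real (card (children x))) * (h x)\<^sup>2)
        - 2 * (\<Sum>x\<in>A - {r}. h x * h (par x))"
    by (simp add: sum.distrib distrib_right)
  also have "(\<Sum>x\<in>A. ((if x = r then 0 else 1) + real (card (children x))) * (h x)\<^sup>2) =
      (\<Sum>x\<in>A. real (graph_degree E x) * (h x)\<^sup>2)"
    using A by (intro sum.cong refl) (auto simp: degree_eq)
  finally show "(\<Sum>x\<in>W. (h x - h (par x))\<^sup>2) =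
      (\<Sum>x\<in>A. real (graph_degree E x) * (h x)\<^sup>2) - 2 * (\<Sum>x\<in>A - {r}. h x * h (par x))" .
qed

lemma I_energy_eq:
  "I_energy E p = (\<Sum>\<^sub>\<infinity>x\<in>V - {r}. ennreal
     ((sqrt (pmf p x / graph_degree E x) - sqrt (pmf p (par x) / graph_degree E (par x)))\<^sup>2))"
proof -
  have "I_energy E p = (\<Sum>\<^sub>\<infinity>x\<in>V - {r}. ennreal (edge_energy E p {x, par x}))"
    unfolding I_energy_def
    by (subst (1) edges) (simp add: infsum_reindex[OF inj_on_edges] o_def)
  also have "\<dots> = (\<Sum>\<^sub>\<infinity>x\<in>V - {r}. ennreal
     ((sqrt (pmf p x / graph_degree E x) - sqrt (pmf p (par x) / graph_degree E (par x)))\<^sup>2))"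
    by (rule infsum_cong) (use par_neq in \<open>fastforce simp: edge_energy_doubleton\<close>)
  finally show ?thesis .
qed

end

section \<open>Rooting a tree\<close>

text \<open>Take the least \<open>l > 0\<close> such that the walk returns to a vertex after
  \<open>l\<close> steps. Loops are excluded by simplicity and \<open>l = 2\<close> by the absence
  of backtracking; minimality makes the \<open>l\<close> vertices distinct, so they form a
  cycle.\<close>

lemma cycle_of_nonbacktracking_walk:
  fixes w :: "nat \<Rightarrow> 'a"
  assumes simple: "simple_graph V E"
    and walk: "\<And>i. i < n \<Longrightarrow> {w i, w (Suc i)} \<in> E"
    and nonbacktracking: "\<And>i. Suc i < n \<Longrightarrow> w i \<noteq> w (Suc (Suc i))"
    and "i < j" "j \<le> n" "w i = w j"
  shows "\<exists>xs. graph_cycle E xs"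
proof -
  define P where "P l \<longleftrightarrow> (\<exists>i. 0 < l \<and> i + l \<le> n \<and> w i = w (i + l))" for l
  have "P (j - i)" using assms by (auto simp: P_def intro!: exI[of _ i])
  then obtain l where l: "P l" "\<And>l'. l' < l \<Longrightarrow> \<not> P l'"
    by (metis exists_least_iff)
  then obtain i where i: "0 < l" "i + l \<le> n" "w i = w (i + l)" by (auto simp: P_def)
  have "l \<noteq> 1" using walk[of i] i simple_graph_edgeD(3)[OF simple, of "w i" "w (Suc i)"] by auto
  moreover have "l \<noteq> 2" using nonbacktracking[of i] i by auto
  ultimately have l3: "l \<ge> 3" using i by simp
  define xs where "xs = map w [i..<i + l]"
  have "inj_on w {i..<i + l}"
  proof (rule linorder_inj_onI)
    fix a b assume ab: "a < b" "a \<in> {i..<i + l}" "b \<in> {i..<i + l}"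
    then have "\<not> P (b - a)" using l(2)[of "b - a"] by auto
    moreover have "0 < b - a \<and> a + (b - a) \<le> n \<and> a + (b - a) = b" using ab i by auto
    ultimately show "w a \<noteq> w b" unfolding P_def by metis
  qed auto
  then have "distinct xs" by (simp add: xs_def distinct_map)
  moreover have "successively (\<lambda>u v. {u, v} \<in> E) xs"
    using walk i by (auto simp: xs_def successively_conv_nth)
  moreover have "last xs = w (i + l - 1)" "hd xs = w (i + l)"
    using i by (auto simp: xs_def last_map last_conv_nth hd_map hd_conv_nth)
  then have "{last xs, hd xs} \<in> E" using walk[of "i + l - 1"] i by simp
  ultimately have "graph_cycle E xs" using l3 by (simp add: graph_cycle_def xs_def)
  then show ?thesis ..
qed

text \<open>Any vertex may serve as the root: \<open>dep\<close> is the distance from it and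
  \<open>par\<close> picks a neighbour one step nearer. An edge that joins no vertex to its parent
  would close a cycle through the paths to the root.\<close>

theorem rooted_tree_of_tree:
  assumes tree: "is_tree V E" and fin: "\<And>x. x \<in> V \<Longrightarrow> finite (neighbours E x)"
  shows "\<exists>r par dep. rooted_tree V E r par dep"
proof -
  let ?R = "{(u, v). {u, v} \<in> E}"
  have simple: "simple_graph V E" and conn: "connected_graph V E" and acyc: "\<nexists>xs. graph_cycle E xs"
    using tree by (auto simp: is_tree_def)
  obtain r where r: "r \<in> V" using conn by (auto simp: connected_graph_def)
  have reach: "\<exists>n. (r, x) \<in> ?R ^^ n" if "x \<in> V" for x
    using conn r that rtrancl_power[of "(r, x)" ?R] by (auto simp: connected_graph_def)
  define dep where "dep x = (LEAST n. (r, x) \<in> ?R ^^ n)" for x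
  have dep: "(r, x) \<in> ?R ^^ dep x" if "x \<in> V" for x
    using reach[OF that] unfolding dep_def by (rule LeastI_ex)
  have dep_le: "dep x \<le> n" if "(r, x) \<in> ?R ^^ n" for x n
    using that unfolding dep_def by (rule Least_le)
  have dep_r: "dep r = 0" using dep_le[of r 0] by simp
  have "\<exists>y. {x, y} \<in> E \<and> dep x = Suc (dep y)" if x: "x \<in> V - {r}" for x
  proof -
    have "dep x \<noteq> 0" using dep[of x] x by (intro notI) auto
    then obtain n where n: "dep x = Suc n" by (cases "dep x") auto
    then obtain y where y: "(r, y) \<in> ?R ^^ n" "{y, x} \<in> E"
      using dep[of x] x relpow_Suc_E[of r x n ?R] by auto
    have "y \<in> V" using y simple_graph_edgeD[OF simple] by blast
    have "(r, x) \<in> ?R ^^ Suc (dep y)"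
      using dep[OF \<open>y \<in> V\<close>] y by (intro relpow_Suc_I) auto
    then have "dep x = Suc (dep y)" using dep_le[OF y(1)] dep_le n by fastforce
    then show ?thesis using y by (auto simp: insert_commute)
  qed
  then obtain par' where par': "\<And>x. x \<in> V - {r} \<Longrightarrow> {x, par' x} \<in> E \<and> dep x = Suc (dep (par' x))"
    by metis
  \<comment> \<open>With \<open>par r = r\<close>, an edge \<open>{x, par x}\<close> with distinct
    ends forces \<open>x \<noteq> r\<close>.\<close>
  define par where "par x = (if x = r then r else par' x)" for x
  have parE: "{x, par x} \<in> E" and dpar: "dep x = Suc (dep (par x))" if "x \<in> V - {r}" for x
    using par'[OF that] that by (auto simp: par_def)
  have parV: "par x \<in> V" if "x \<in> V - {r}" for x
    using parE[OF that] simple_graph_edgeD[OF simple] by blast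
  have up: "(par ^^ k) x \<in> V \<and> dep ((par ^^ k) x) = dep x - k" if "x \<in> V" "k \<le> dep x" for x k
    using that(2)
  proof (induction k)
    case (Suc k)
    then have "(par ^^ k) x \<in> V - {r}" using dep_r by force
    with parV[OF this] dpar[OF this] Suc show ?case by auto
  qed (use that in auto)
  have up_ne: "(par ^^ k) x \<in> V - {r}" if "x \<in> V" "k < dep x" for x k
    using up[of x k] that dep_r by force
  have up_root: "(par ^^ dep x) x = r" if "x \<in> V" for x
    using up[of x "dep x"] dpar[of "(par ^^ dep x) x"] that by auto
  have edge: "y = par x \<or> x = par y" if xy: "{x, y} \<in> E" for x y
  proof (rule ccontr)
    assume contra: "\<not> ?thesis"
    have V: "x \<in> V" "y \<in> V" using simple_graph_edgeD[OF simple xy] by auto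
    define a b where "a = dep x" and "b = dep y"
    \<comment> \<open>The walk from the root to \<open>x\<close>, across the edge and back from \<open>y\<close> to the root does not backtrack.\<close>
    define w where "w i = (if i \<le> a then (par ^^ (a - i)) x else (par ^^ (i - Suc a)) y)" for i
    have walk: "{w i, w (Suc i)} \<in> E" if "i < Suc (a + b)" for i
    proof -
      consider "i < a" | "i = a" | "i > a" by linarith
      then show ?thesis
      proof cases
        case 1
        then have "a - i = Suc (a - Suc i)" by simp
        then show ?thesis using 1 parE[OF up_ne[of x "a - Suc i"]] V
          by (simp add: w_def a_def insert_commute)
      next
        case 2
        then show ?thesis using xy by (simp add: w_def)
      next
        case 3
        then have "Suc i - Suc a = Suc (i - Suc a)" by simp
        then show ?thesis using 3 parE[OF up_ne[of y "i - Suc a"]] V that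
          by (simp add: w_def b_def)
      qed
    qed
    have nb: "w i \<noteq> w (Suc (Suc i))" if "Suc i < Suc (a + b)" for i
    proof -
      \<comment> \<open>Along either leg the two depths differ by two. At the turn the vertices to
        be distinguished are \<open>par x\<close> and \<open>y\<close>, or \<open>x\<close> and
        \<open>par y\<close>, which differ by \<open>contra\<close>.\<close>
      consider "Suc (Suc i) \<le> a" | "Suc i = a" | "i = a" | "i > a" by linarith
      then show ?thesis
      proof cases
        case 1
        then have "dep (w i) = i" "dep (w (Suc (Suc i))) = Suc (Suc i)"
          using up[of x "a - i"] up[of x "a - Suc (Suc i)"] V by (auto simp: w_def a_def)
        then show ?thesis by fastforce
      next
        case 2
        then have "a - i = 1" by simp
        then show ?thesis using 2 contra by (auto simp: w_def)
      next
        case 3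
        then show ?thesis using contra by (auto simp: w_def)
      next
        case 4
        then have "dep (w i) = b - (i - Suc a)" "dep (w (Suc (Suc i))) = b - (Suc i - a)"
          using up[of y "i - Suc a"] up[of y "Suc i - a"] V that by (auto simp: w_def b_def)
        moreover have "b - (i - Suc a) \<noteq> b - (Suc i - a)" using 4 that by auto
        ultimately show ?thesis by fastforce
      qed
    qed
    have "w 0 = w (Suc (a + b))" using up_root V by (simp add: w_def a_def b_def)
    then have "\<exists>xs. graph_cycle E xs"
      using walk nb by (intro cycle_of_nonbacktracking_walk[OF simple, of "Suc (a + b)" w 0]) auto
    then show False using acyc by blast
  qed
  have "E = (\<lambda>x. {x, par x}) ` (V - {r})"
  proof (intro equalityI subsetI)
    fix e assume e: "e \<in> E"
    then obtain x y where xy: "x \<in> V" "y \<in> V" "x \<noteq> y" "e = {x, y}"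
      using simple by (fastforce simp: simple_graph_def)
    then have "y = par x \<or> x = par y" using edge e by simp
    moreover have "par r = r" by (simp add: par_def)
    ultimately have "y = par x \<and> x \<in> V - {r} \<or> x = par y \<and> y \<in> V - {r}" using xy by auto
    then show "e \<in> (\<lambda>x. {x, par x}) ` (V - {r})"
      using xy(4) insert_commute[of x y "{}"] by (elim disjE) auto
  qed (use parE in auto)
  then have "rooted_tree V E r par dep"
    by unfold_locales (use r dep_r parV dpar fin in auto)
  then show ?thesis by blast
qed

lemma rooted_tree_hom_tree:
  assumes "d \<ge> 1"
  shows "rooted_tree (hom_tree_verts d) (hom_tree_edges d) [] butlast length"
proof
  show "hom_tree_edges d = (\<lambda>x. {x, butlast x}) ` (hom_tree_verts d - {[]})"
  proof (intro equalityI subsetI)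
    fix e assume "e \<in> hom_tree_edges d"
    then obtain xs i where "e = {xs, xs @ [i]}" "xs @ [i] \<in> hom_tree_verts d"
      by (auto simp: hom_tree_edges_def)
    then show "e \<in> (\<lambda>x. {x, butlast x}) ` (hom_tree_verts d - {[]})"
      by (intro image_eqI[of _ _ "xs @ [i]"]) auto
  qed (auto simp: hom_tree_edge_iff)
  fix x assume "x \<in> hom_tree_verts d - {[]}"
  then show "butlast x \<in> hom_tree_verts d"
    using hom_tree_verts_snoc[of "butlast x" "last x"] by simp
qed (use assms degree_hom_tree in \<open>auto simp: Nil_in_hom_tree_verts\<close>)


section \<open>Selecting an optimal regular subtree\<close>

text \<open>Deleting an element of largest value does not raise the average; this is repeated until
  \<open>k\<close> elements remain.\<close>

lemma exists_subset_sum_le_average: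
  fixes f :: "'a \<Rightarrow> real"
  assumes "finite C" "k \<le> card C"
  shows "\<exists>C'\<subseteq>C. card C' = k \<and> real (card C) * sum f C' \<le> real k * sum f C"
  using assms
proof (induction "card C - k" arbitrary: C)
  case 0
  then show ?case by (intro exI[of _ C]) auto
next
  case (Suc m)
  define n where "n = card C"
  show ?case
  proof (cases "k = 0")
    case False
    have "C \<noteq> {}" using Suc.hyps by auto
    then obtain x where x: "x \<in> C" "f x = Max (f ` C)"
      using Max_in[of "f ` C"] Suc.prems by fastforce
    have "sum f C \<le> real n * f x"
      using Suc.prems x by (simp add: n_def sum_bounded_above)
    then have "sum f (C - {x}) * real n \<le> (real n - 1) * sum f C"
      using x Suc.prems by (simp add: sum_diff1 algebra_simps)
    then have le: "real k * (sum f (C - {x}) * real n) \<le> real k * ((real n - 1) * sum f C)"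
      by (rule mult_left_mono) simp
    have card: "card (C - {x}) = n - 1" using x Suc.prems by (simp add: n_def)
    have n: "n > 1" "n > k" using Suc False by (auto simp: n_def)
    obtain C' where C': "C' \<subseteq> C - {x}" "card C' = k"
        "real (n - 1) * sum f C' \<le> real k * sum f (C - {x})"
      using Suc.hyps(1)[of "C - {x}"] Suc.hyps(2) Suc.prems n unfolding card
      by (fastforce simp: n_def of_nat_diff)
    have "real n * (real (n - 1) * sum f C') \<le> real n * (real k * sum f (C - {x}))"
      using C'(3) by (rule mult_left_mono) simp
    also have "\<dots> \<le> real k * ((real n - 1) * sum f C)" using le by (simp add: mult_ac)
    finally have "real (n - 1) * (real n * sum f C') \<le> real (n - 1) * (real k * sum f C)"
      using n by (simp add: of_nat_diff mult_ac)
    then have "real n * sum f C' \<le> real k * sum f C" using n by (simp add: mult_le_cancel_left_pos)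
    then show ?thesis using C' by (auto simp: n_def intro!: exI[of _ C'])
  qed (auto intro: exI[of _ "{}"])
qed

text \<open>Words over \<open>d - 1\<close> letters address a single branch, whose top has
  \<open>d - 1\<close> children like every other vertex in it. A first letter below \<open>d\<close>
  selects one of the \<open>d\<close> branches at the root.\<close>

lemma Cons_in_hom_tree_verts:
  assumes "i < d" "ys \<in> lists {..<d - 1}"
  shows "i # ys \<in> hom_tree_verts d"
  using assms by (auto simp: hom_tree_verts_def nth_Cons in_lists_conv_set split: nat.splits)

lemma lists_subset_hom_tree_verts: "lists {..<d - 1} \<subseteq> hom_tree_verts d"
proof
  fix xs assume "xs \<in> lists {..<d - 1}"
  then have "xs ! j < d - 1" if "j < length xs" for j
    using that nth_mem[of j xs] by (auto simp: in_lists_conv_set)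
  then show "xs \<in> hom_tree_verts d" by (fastforce simp: hom_tree_verts_def)
qed

section \<open>Finite subtrees as parts of the homogeneous tree\<close>

context rooted_tree
begin

text \<open>\<open>B\<close> is a finite subtree with top \<open>v\<close>, and
  \<open>\<psi>\<close> labels it by addresses, taking parents to parents. With
  \<open>Y = hom_tree_verts d\<close> the top may have up to \<open>d\<close> children in
  \<open>B\<close>; with \<open>Y = lists {..<d - 1}\<close> it may have up to \<open>d - 1\<close>,
  which leaves room for a parent.\<close>

definition embeds :: "nat list set \<Rightarrow> 'a \<Rightarrow> 'a set \<Rightarrow> ('a \<Rightarrow> nat list) \<Rightarrow> bool" where
  "embeds Y v B \<psi> \<longleftrightarrow> finite B \<and> B \<subseteq> V \<and> v \<in> B \<and> inj_on \<psi> B \<and> \<psi> ` B \<subseteq> Y \<and> \<psi> v = [] \<and>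
     (\<forall>x\<in>B - {v}. par x \<in> B \<and> \<psi> x \<noteq> [] \<and> \<psi> (par x) = butlast (\<psi> x))"

text \<open>The children in \<open>C\<close> are numbered by \<open>e\<close>, and the number of a
  child is put in front of the addresses in its branch.\<close>

lemma embeds_join:
  assumes v: "v \<in> V" and C: "C \<subseteq> children v" "card C = k"
    and B: "\<And>c. c \<in> C \<Longrightarrow> embeds Y c (B c) (\<psi> c) \<and> B c \<subseteq> desc n c"
  shows "\<exists>\<phi>. embeds (insert [] {i # ys | i ys. i < k \<and> ys \<in> Y}) v (insert v (\<Union>c\<in>C. B c)) \<phi>"
proof -
  have fin: "finite C" using C v finite_children finite_subset by blast
  obtain e where e: "bij_betw e C {0..<k}" using ex_bij_betw_finite_nat[OF fin] C by blast
  \<comment> \<open>For \<open>x\<close> in a branch, \<open>a x\<close> is the child of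
    \<open>v\<close> whose branch contains \<open>x\<close>.\<close>
  define a where "a x = (par ^^ (dep x - Suc (dep v))) x" for x
  define \<phi> where "\<phi> x = (if x = v then [] else e (a x) # \<psi> (a x) x)" for x
  have a: "a x = c \<and> x \<noteq> v" if "c \<in> C" "x \<in> B c" for x c
  proof -
    have "x \<in> desc n c" "dep c = Suc (dep v)" using that B C childrenD by blast+
    then show ?thesis using desc_ancestor[of x n c] dep_desc[of x n c] by (auto simp: a_def)
  qed
  have \<phi>: "\<phi> x = e c # \<psi> c x" if "c \<in> C" "x \<in> B c" for x c
    using a[OF that] by (simp add: \<phi>_def)
  have "inj_on \<phi> (insert v (\<Union>c\<in>C. B c))"
  proof (rule inj_onI)
    fix x y
    assume x: "x \<in> insert v (\<Union>c\<in>C. B c)" and y: "y \<in> insert v (\<Union>c\<in>C. B c)" and xy: "\<phi> x = \<phi> y"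
    show "x = y"
    proof (cases "x = v \<or> y = v")
      case True
      then show ?thesis using xy by (auto simp: \<phi>_def split: if_splits)
    next
      case False
      then obtain c c' where c: "c \<in> C" "x \<in> B c" "c' \<in> C" "y \<in> B c'" using x y by blast
      then have "e c = e c'" "\<psi> c x = \<psi> c' y" using xy \<phi> by auto
      then have "c = c'" using e c by (auto simp: bij_betw_def dest: inj_onD)
      then show ?thesis using B[of c] c \<open>\<psi> c x = \<psi> c' y\<close> by (auto simp: embeds_def dest: inj_onD)
    qed
  qed
  moreover have "\<phi> ` insert v (\<Union>c\<in>C. B c) \<subseteq> insert [] {i # ys | i ys. i < k \<and> ys \<in> Y}"
  proof -
    have "e c < k" if "c \<in> C" for c using e that by (auto simp: bij_betw_def)
    then show ?thesis using \<phi> B by (fastforce simp: \<phi>_def[of v] embeds_def)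
  qed
  moreover have "par x \<in> insert v (\<Union>c\<in>C. B c) \<and> \<phi> x \<noteq> [] \<and> \<phi> (par x) = butlast (\<phi> x)"
    if x: "x \<in> insert v (\<Union>c\<in>C. B c) - {v}" for x
  proof -
    obtain c where c: "c \<in> C" "x \<in> B c" using x by blast
    have emb: "embeds Y c (B c) (\<psi> c)" using B c by blast
    show ?thesis
    proof (cases "x = c")
      case True
      then have "par x = v" using C c childrenD by blast
      moreover have "\<psi> c x = []" using emb True by (simp add: embeds_def)
      ultimately show ?thesis using \<phi>[OF c] by (simp add: \<phi>_def[of v])
    next
      case False
      then have "par x \<in> B c" "\<psi> c x \<noteq> []" "\<psi> c (par x) = butlast (\<psi> c x)"
        using emb c by (auto simp: embeds_def)
      then show ?thesis using \<phi>[OF c] \<phi>[OF c(1), of "par x"] c by auto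
    qed
  qed
  moreover have "finite (insert v (\<Union>c\<in>C. B c))" "insert v (\<Union>c\<in>C. B c) \<subseteq> V"
    using fin B v unfolding embeds_def by simp_all blast
  ultimately have "embeds (insert [] {i # ys | i ys. i < k \<and> ys \<in> Y}) v (insert v (\<Union>c\<in>C. B c)) \<phi>"
    unfolding embeds_def by (simp add: \<phi>_def[of v])
  then show ?thesis by blast
qed

lemma embeds_mono: "embeds Y v B \<psi> \<Longrightarrow> Y \<subseteq> Y' \<Longrightarrow> embeds Y' v B \<psi>"
  by (auto simp: embeds_def)

text \<open>Here \<open>nonneg\<close> is the linear inequality for one finite subtree with top
  \<open>v\<close>. Its last term cancels the edge from \<open>v\<close> to its parent, which does
  not belong to the subtree; for \<open>v = r\<close> it cancels a term with no meaning.\<close>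

context
  fixes d :: nat and \<alpha> h :: "'a \<Rightarrow> real"
  assumes d: "d \<ge> 2" and degree: "\<And>x. x \<in> V \<Longrightarrow> d \<le> graph_degree E x"
    and nonneg: "\<And>v B \<psi>. embeds (hom_tree_verts d) v B \<psi> \<Longrightarrow>
      0 \<le> (\<Sum>x\<in>B. real d * \<alpha> x - 2 * h x * h (par x)) + 2 * h v * h (par v)"
begin

text \<open>\<open>d\<close> branches joined below \<open>v\<close> form a subtree with top
  \<open>v\<close>, to which \<open>nonneg\<close> applies.\<close>

lemma sum_branches_nonneg:
  assumes v: "v \<in> V" and C: "C \<subseteq> children v" "card C = d"
    and B: "\<And>c. c \<in> C \<Longrightarrow> embeds (lists {..<d - 1}) c (B c) (\<psi> c) \<and> B c \<subseteq> desc n c"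
  shows "0 \<le> real d * \<alpha> v + (\<Sum>c\<in>C. \<Sum>x\<in>B c. real d * \<alpha> x - 2 * h x * h (par x))"
proof -
  have sub: "insert [] {i # ys | i ys. i < d \<and> ys \<in> lists {..<d - 1}} \<subseteq> hom_tree_verts d"
    using Cons_in_hom_tree_verts Nil_in_hom_tree_verts by blast
  have "\<exists>\<phi>. embeds (insert [] {i # ys | i ys. i < d \<and> ys \<in> lists {..<d - 1}}) v
      (insert v (\<Union>c\<in>C. B c)) \<phi>"
    using embeds_join[OF v C, of "lists {..<d - 1}" B \<psi> n] B by simp
  then obtain \<phi> where "embeds (hom_tree_verts d) v (insert v (\<Union>c\<in>C. B c)) \<phi>"
    by (elim exE) (rule that, erule embeds_mono[OF _ sub])
  note nonneg[OF this]
  also have "(\<Sum>x\<in>insert v (\<Union>c\<in>C. B c). real d * \<alpha> x - 2 * h x * h (par x)) =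
      real d * \<alpha> v - 2 * h v * h (par v) + (\<Sum>c\<in>C. \<Sum>x\<in>B c. real d * \<alpha> x - 2 * h x * h (par x))"
    by (rule sum_children_union[OF v C(1), of B n]) (use B in simp)
  finally show ?thesis by simp
qed

text \<open>Induction from the leaves upwards, keeping \<open>d - 1\<close> of the branches below
  \<open>v\<close>. Both sums include the edge from \<open>v\<close> to its parent, so that the
  branch can be attached one level higher.\<close>

lemma branch_minimum:
  assumes "v \<in> V - {r}"
  shows "\<exists>B \<psi>. embeds (lists {..<d - 1}) v B \<psi> \<and> B \<subseteq> desc n v \<and>
     (\<Sum>x\<in>B. real d * \<alpha> x - 2 * h x * h (par x)) \<le>
     (\<Sum>x\<in>desc n v. real (graph_degree E x) * \<alpha> x - 2 * h x * h (par x))"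
  using assms
proof (induction n arbitrary: v)
  case (0 v)
  have emb: "embeds (lists {..<d - 1}) v {v} (\<lambda>_. [])" using 0 by (simp add: embeds_def)
  \<comment> \<open>A single vertex is a subtree, hence \<open>\<alpha> v\<close> is nonnegative and
    the coefficient may be raised from \<open>d\<close> to the degree.\<close>
  have "0 \<le> real d * \<alpha> v"
    using nonneg[OF embeds_mono[OF emb lists_subset_hom_tree_verts]] by simp
  then have "real d * \<alpha> v \<le> real (graph_degree E v) * \<alpha> v"
    using d degree[of v] 0 by (intro mult_right_mono) (auto simp: zero_le_mult_iff)
  then show ?case using emb 0
    by (intro exI[of _ "{v}"] exI[of _ "\<lambda>_. []"]) (auto simp: desc_0)
next
  case (Suc n v)
  define w where "w x = real d * \<alpha> x - 2 * h x * h (par x)" for x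
  define w' where "w' x = real (graph_degree E x) * \<alpha> x - 2 * h x * h (par x)" for x
  have v: "v \<in> V" "v \<noteq> r" using Suc.prems by auto
  have "\<exists>B \<psi>. embeds (lists {..<d - 1}) c B \<psi> \<and> B \<subseteq> desc n c \<and> sum w B \<le> sum w' (desc n c)"
    if "c \<in> children v" for c
    using Suc.IH[of c] childrenD[OF that] by (simp add: w_def w'_def)
  then obtain B \<psi> where B: "\<And>c. c \<in> children v \<Longrightarrow> embeds (lists {..<d - 1}) c (B c) (\<psi> c) \<and>
      B c \<subseteq> desc n c \<and> sum w (B c) \<le> sum w' (desc n c)"
    by metis
  define N where "N = card (children v)"
  define f where "f c = sum w (B c)" for c
  define X where "X = (\<Sum>c\<in>children v. f c)"
  have fin: "finite (children v)" using finite_children v by blast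
  have deg: "graph_degree E v = N + 1" using degree_eq v by (simp add: N_def)
  then have N: "N \<ge> d - 1" "N \<ge> 1" using degree[of v] v d by auto
  obtain C where C: "C \<subseteq> children v" "card C = d - 1" "real N * sum f C \<le> real (d - 1) * X"
    using exists_subset_sum_le_average[OF fin, of "d - 1" f] N by (auto simp: N_def X_def)
  have key: "real d * \<alpha> v + sum f C \<le> real (N + 1) * \<alpha> v + X"
  proof (cases "N \<ge> d")
    case True
    \<comment> \<open>With \<open>d\<close> branches instead of \<open>d - 1\<close>,
      \<open>v\<close> becomes the top of a subtree; averaging over all children turns its
      inequality into \<open>0 \<le> real N * \<alpha> v + X\<close>.\<close>
    obtain C2 where C2: "C2 \<subseteq> children v" "card C2 = d" "real N * sum f C2 \<le> real d * X"
      using exists_subset_sum_le_average[OF fin, of d f] True by (auto simp: N_def X_def)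
    have "0 \<le> real d * \<alpha> v + sum f C2"
      unfolding f_def w_def by (rule sum_branches_nonneg[OF v(1) C2(1,2), of B \<psi> n]) (simp only: B subsetD[OF C2(1)])
    then have "0 \<le> real N * (real d * \<alpha> v + sum f C2)" by (intro mult_nonneg_nonneg) auto
    also have "\<dots> \<le> real d * (real N * \<alpha> v + X)" using C2(3) by (simp add: algebra_simps)
    finally have "0 \<le> real N * \<alpha> v + X" using d by (simp add: zero_le_mult_iff)
    \<comment> \<open>After multiplication by \<open>N\<close>, the two sides of \<open>key\<close>
      differ by at least this product, by the choice of \<open>C\<close>.\<close>
    then have "0 \<le> (real N + 1 - real d) * (real N * \<alpha> v + X)"
      using True by (intro mult_nonneg_nonneg) auto
    then have "real N * (real d * \<alpha> v + sum f C) \<le> real N * (real (N + 1) * \<alpha> v + X)"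
      using C(3) d by (simp add: algebra_simps of_nat_diff)
    then show ?thesis using N by (simp add: mult_le_cancel_left_pos)
  next
    case False
    \<comment> \<open>The degree of \<open>v\<close> is exactly \<open>d\<close>: every child is
      kept and \<open>key\<close> is an equality.\<close>
    then have Nd: "N = d - 1" using N by simp
    then have "C = children v" using C fin by (metis N_def card_subset_eq)
    then show ?thesis using Nd d by (simp add: X_def)
  qed
  define T where "T = insert v (\<Union>c\<in>C. B c)"
  have "sum w T = w v + sum f C"
    unfolding T_def f_def by (rule sum_children_union[OF v(1) C(1), of B n]) (simp only: B subsetD[OF C(1)])
  also have "\<dots> \<le> w' v + X" using key deg by (simp add: w_def w'_def)
  also have "X \<le> (\<Sum>c\<in>children v. sum w' (desc n c))"
    unfolding X_def f_def by (intro sum_mono) (simp add: B)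
  also have "w' v + (\<Sum>c\<in>children v. sum w' (desc n c)) = sum w' (desc (Suc n) v)"
    unfolding desc_Suc[OF v(1)] by (rule sum_children_union[OF v(1), symmetric]) auto
  finally have le: "sum w T \<le> sum w' (desc (Suc n) v)" by simp
  have sub: "insert [] {i # ys | i ys. i < d - 1 \<and> ys \<in> lists {..<d - 1}} \<subseteq> lists {..<d - 1}"
    by auto
  have "\<exists>\<phi>. embeds (insert [] {i # ys | i ys. i < d - 1 \<and> ys \<in> lists {..<d - 1}}) v T \<phi>"
    using embeds_join[OF v(1) C(1,2), of "lists {..<d - 1}" B \<psi> n] B[OF subsetD[OF C(1)]]
    by (simp add: T_def)
  then obtain \<phi> where "embeds (lists {..<d - 1}) v T \<phi>"
    by (elim exE) (rule that, erule embeds_mono[OF _ sub])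
  moreover have "B c \<subseteq> desc n c" if "c \<in> C" for c using B[OF subsetD[OF C(1) that]] by simp
  then have "T \<subseteq> desc (Suc n) v"
    unfolding T_def desc_Suc[OF v(1)] using C(1) by blast
  ultimately show ?case using le unfolding w_def w'_def by blast
qed

text \<open>The root has no parent, so \<open>d\<close> of its branches are kept and
  \<open>sum_branches_nonneg\<close> applies; averaging over all children restores the full
  degree.\<close>

lemma tree_sum_nonneg:
  "0 \<le> (\<Sum>x\<in>desc (Suc n) r. real (graph_degree E x) * \<alpha> x - 2 * h x * h (par x)) + 2 * h r * h (par r)"
proof -
  define w where "w x = real d * \<alpha> x - 2 * h x * h (par x)" for x
  define w' where "w' x = real (graph_degree E x) * \<alpha> x - 2 * h x * h (par x)" for x
  have "\<exists>B \<psi>. embeds (lists {..<d - 1}) c B \<psi> \<and> B \<subseteq> desc n c \<and> sum w B \<le> sum w' (desc n c)"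
    if "c \<in> children r" for c
    using branch_minimum[of c n] childrenD[OF that] by (simp add: w_def w'_def)
  then obtain B \<psi> where B: "\<And>c. c \<in> children r \<Longrightarrow> embeds (lists {..<d - 1}) c (B c) (\<psi> c) \<and>
      B c \<subseteq> desc n c \<and> sum w (B c) \<le> sum w' (desc n c)"
    by metis
  define N where "N = card (children r)"
  define f where "f c = sum w (B c)" for c
  define X where "X = (\<Sum>c\<in>children r. f c)"
  have deg: "graph_degree E r = N" using degree_eq root by (simp add: N_def)
  have N: "N \<ge> d" using degree[of r] root deg by auto
  obtain C where C: "C \<subseteq> children r" "card C = d" "real N * sum f C \<le> real d * X"
    using exists_subset_sum_le_average[OF finite_children, of r d f] N root by (auto simp: N_def X_def)
  have "0 \<le> real d * \<alpha> r + sum f C"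
    unfolding f_def w_def by (rule sum_branches_nonneg[OF root(1) C(1,2), of B \<psi> n]) (simp only: B subsetD[OF C(1)])
  then have "0 \<le> real N * (real d * \<alpha> r + sum f C)" by (intro mult_nonneg_nonneg) auto
  also have "\<dots> \<le> real d * (real N * \<alpha> r + X)" using C(3) by (simp add: algebra_simps)
  finally have "0 \<le> real N * \<alpha> r + X" using d by (simp add: zero_le_mult_iff)
  also have "X \<le> (\<Sum>c\<in>children r. sum w' (desc n c))"
    unfolding X_def f_def by (intro sum_mono) (simp add: B)
  finally have "0 \<le> w' r + (\<Sum>c\<in>children r. sum w' (desc n c)) + 2 * h r * h (par r)"
    using deg by (simp add: w'_def)
  also have "w' r + (\<Sum>c\<in>children r. sum w' (desc n c)) = sum w' (desc (Suc n) r)"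
    unfolding desc_Suc[OF root(1)] by (rule sum_children_union[OF root(1), symmetric]) auto
  finally show ?thesis by (simp add: w'_def)
qed

end

end

section \<open>Finitely supported functions on the homogeneous tree\<close>

text \<open>The bound \<open>ln t \<le> t - 1\<close> at \<open>t = p x / q x\<close>, summed over
  \<open>B\<close>. The masses are compared by an inequality because \<open>p\<close> may charge
  points outside \<open>B\<close>.\<close>

lemma gibbs_inequality:
  fixes p q :: "'a \<Rightarrow> real"
  assumes "finite B" and p: "\<And>x. x \<in> B \<Longrightarrow> p x \<ge> 0" and q: "\<And>x. x \<in> B \<Longrightarrow> q x \<ge> 0"
    and pq: "\<And>x. x \<in> B \<Longrightarrow> q x > 0 \<Longrightarrow> p x > 0" and "sum p B \<le> sum q B"
  shows "(\<Sum>x\<in>B. - (q x * ln (q x))) \<le> (\<Sum>x\<in>B. - (q x * ln (p x)))"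
proof -
  have "- (q x * ln (q x)) \<le> - (q x * ln (p x)) + (p x - q x)" if "x \<in> B" for x
  proof (cases "q x = 0")
    case False
    then have pos: "q x > 0" "p x > 0" using q[OF that] pq[OF that] by auto
    have "q x * ln (p x / q x) \<le> q x * (p x / q x - 1)"
      using pos by (intro mult_left_mono ln_le_minus_one) auto
    then show ?thesis using pos by (simp add: ln_div algebra_simps)
  qed (use p that in simp)
  then have "(\<Sum>x\<in>B. - (q x * ln (q x))) \<le> (\<Sum>x\<in>B. - (q x * ln (p x)) + (p x - q x))"
    by (rule sum_mono)
  then show ?thesis using assms(5) by (simp only: sum.distrib sum_subtractf)
qed

lemma pmf_embed_finite:
  fixes q :: "'a \<Rightarrow> real"
  assumes "finite B" "\<And>x. x \<in> B \<Longrightarrow> q x \<ge> 0" "sum q B = 1"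
  obtains P where "\<And>x. pmf P x = (if x \<in> B then q x else 0)"
proof -
  let ?F = "\<lambda>x. if x \<in> B then q x else 0"
  have "(\<integral>\<^sup>+x. ennreal (?F x) \<partial>count_space UNIV) = (\<Sum>x\<in>B. ennreal (q x))"
    using assms(1) by (subst nn_integral_count_space'[of B]) auto
  also have "\<dots> = 1" using assms by (subst sum_ennreal) auto
  finally have "pmf (embed_pmf ?F) x = ?F x" for x using assms(2) by (intro pmf_embed_pmf) auto
  then show ?thesis using that by blast
qed

text \<open>The weights \<open>d * h\<^sup>2\<close> are normalised to a probability
  \<open>q\<close> on \<open>B\<close> and carried by \<open>\<psi>\<close> to the homogeneous tree,
  where the energy plus \<open>\<rho>\<close> times the entropy is at least
  \<open>c\<close>.\<close>

lemma hom_tree_lower_bound: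
  fixes h :: "'a \<Rightarrow> real" and p :: "'a pmf"
  assumes d: "d \<ge> 1" and \<rho>: "\<rho> > 0" and c: "0 \<le> c" "ennreal c \<le> chi (hom_tree_verts d) (hom_tree_edges d) \<rho>"
    and B: "finite B" "v \<in> B" and \<psi>: "inj_on \<psi> B" "\<psi> ` B \<subseteq> hom_tree_verts d" "\<psi> v = []"
    and par: "\<And>x. x \<in> B - {v} \<Longrightarrow> par x \<in> B \<and> \<psi> x \<noteq> [] \<and> \<psi> (par x) = butlast (\<psi> x)"
    and h: "\<And>x. x \<in> B \<Longrightarrow> h x \<ge> 0" "\<And>x. x \<in> B \<Longrightarrow> h x > 0 \<Longrightarrow> pmf p x > 0"
  shows "0 \<le> (\<Sum>x\<in>B. real d * ((h x)\<^sup>2 * (1 - \<rho> * ln (pmf p x) - c))) - 2 * (\<Sum>x\<in>B - {v}. h x * h (par x))"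
proof -
  let ?V = "hom_tree_verts d" and ?E = "hom_tree_edges d"
  interpret H: rooted_tree ?V ?E "[]" butlast length by (rule rooted_tree_hom_tree[OF d])
  define N where "N = (\<Sum>x\<in>B. real d * (h x)\<^sup>2)"
  have N0: "N \<ge> 0" unfolding N_def by (intro sum_nonneg) auto
  show ?thesis
  proof (cases "N = 0")
    case True
    then have "h x = 0" if "x \<in> B" for x
      using that B d by (auto simp: N_def sum_nonneg_eq_0_iff)
    then show ?thesis by simp
  next
    case False
    then have N: "N > 0" using N0 by simp
    define q where "q x = real d * (h x)\<^sup>2 / N" for x
    have q0: "q x \<ge> 0" for x using N by (simp add: q_def)
    have sumq: "sum q B = 1"
      using N by (simp add: q_def N_def sum_divide_distrib[symmetric])
    obtain P where P: "\<And>x. pmf P x = (if x \<in> B then q x else 0)"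
      using pmf_embed_finite[OF B(1), of q] q0 sumq by blast
    have setP: "set_pmf P \<subseteq> B" using P by (auto simp: set_pmf_iff split: if_splits)
    define Q where "Q = map_pmf \<psi> P"
    \<comment> \<open>The transport lemma is stated for a simple graph; the edgeless graph on
      \<open>B\<close> is used.\<close>
    have Q: "pmf Q (\<psi> x) = q x" if "x \<in> B" for x
      unfolding Q_def using pmf_map_image[of B "{}" \<psi> P x] \<psi> setP that P
      by (simp add: simple_graph_def)
    have setQ: "set_pmf Q \<subseteq> \<psi> ` B" using setP by (auto simp: Q_def)
    have Q_out: "pmf Q y = 0" if "y \<notin> \<psi> ` B" for y using setQ that by (auto simp: set_pmf_iff)
    define g where "g y = sqrt (pmf Q y / real d)" for y
    have g: "g (\<psi> x) = h x / sqrt N" if "x \<in> B" for x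
      using Q[OF that] d h(1)[OF that] by (simp add: g_def q_def real_sqrt_divide)
    let ?W = "{x \<in> ?V - {[]}. x \<in> \<psi> ` B \<or> butlast x \<in> \<psi> ` B}"
    define i where "i = (\<Sum>x\<in>B. real d * (h x)\<^sup>2) / N - 2 * (\<Sum>x\<in>B - {v}. h x * h (par x)) / N"
    have finA: "finite (\<psi> ` B)" using B by simp
    have g_out: "\<forall>x\<in>?V - \<psi> ` B. g x = 0" by (simp add: g_def Q_out)
    note ssd = H.sum_square_differences[OF finA \<psi>(2) g_out]
    have "I_energy ?E Q = (\<Sum>\<^sub>\<infinity>x\<in>?V - {[]}. ennreal ((g x - g (butlast x))\<^sup>2))"
      unfolding H.I_energy_eq using H.par degree_hom_tree(2)[OF _ d]
      by (intro infsum_cong) (simp add: g_def)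
    also have "\<dots> = (\<Sum>\<^sub>\<infinity>x\<in>?W. ennreal ((g x - g (butlast x))\<^sup>2))"
    proof (rule infsum_cong_neutral)
      fix x assume "x \<in> ?V - {[]} - ?W"
      from ssd(2)[OF this] show "ennreal ((g x - g (butlast x))\<^sup>2) = 0" by simp
    qed auto
    also have "\<dots> = ennreal (\<Sum>x\<in>?W. (g x - g (butlast x))\<^sup>2)"
      using ssd(1) by (simp add: sum_ennreal)
    also have "(\<Sum>x\<in>?W. (g x - g (butlast x))\<^sup>2) = i"
    proof -
      have "(\<Sum>y\<in>\<psi> ` B. real (graph_degree ?E y) * (g y)\<^sup>2) = (\<Sum>x\<in>B. real d * (h x / sqrt N)\<^sup>2)"
        unfolding sum.reindex[OF \<psi>(1)] using \<psi>(2) degree_hom_tree(2)[OF _ d] g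
        by (intro sum.cong) (auto simp: image_subset_iff)
      moreover have "(\<Sum>y\<in>\<psi> ` B - {[]}. g y * g (butlast y)) = (\<Sum>x\<in>B - {v}. h x * h (par x)) / N"
      proof -
        \<comment> \<open>Only the top \<open>v\<close> is sent to the root, so the inner edges of
          \<open>B\<close> correspond to those of its image.\<close>
        have "\<psi> ` B - {[]} = \<psi> ` (B - {v})" using \<psi>(3) par by auto
        then have "(\<Sum>y\<in>\<psi> ` B - {[]}. g y * g (butlast y)) = (\<Sum>x\<in>B - {v}. g (\<psi> x) * g (butlast (\<psi> x)))"
          using sum.reindex[OF inj_on_subset[OF \<psi>(1)], of "B - {v}"] by simp
        also have "\<dots> = (\<Sum>x\<in>B - {v}. h x * h (par x) / N)"
        proof (rule sum.cong[OF refl])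
          fix x assume x: "x \<in> B - {v}"
          then have "g (butlast (\<psi> x)) = h (par x) / sqrt N" using par[OF x] g by metis
          then show "g (\<psi> x) * g (butlast (\<psi> x)) = h x * h (par x) / N"
            using g[of x] x N by simp
        qed
        finally show ?thesis by (simp add: sum_divide_distrib)
      qed
      ultimately show ?thesis
        unfolding ssd(3) i_def using N
        by (simp add: power_divide sum_divide_distrib[symmetric])
    qed
    finally have I: "I_energy ?E Q = ennreal i" .
    have i0: "i \<ge> 0"
      using \<open>(\<Sum>x\<in>?W. (g x - g (butlast x))\<^sup>2) = i\<close> by (metis (no_types, lifting) sum_nonneg zero_le_power2)
    define j where "j = (\<Sum>x\<in>B. - (q x * ln (q x)))"
    have nonneg: "0 \<le> - (q x * ln (q x))" if "x \<in> B" for x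
    proof -
      have "q x \<le> 1" using Q[OF that] pmf_le_1[of Q "\<psi> x"] by simp
      then show ?thesis using q0[of x] by (cases "q x = 0") (auto simp: mult_le_0_iff)
    qed
    have "J_entropy ?V Q = (\<Sum>\<^sub>\<infinity>y\<in>\<psi> ` B. ennreal (- (pmf Q y * ln (pmf Q y))))"
      unfolding J_entropy_def using \<psi>(2) by (intro infsum_cong_neutral) (auto simp: Q_out)
    also have "\<dots> = (\<Sum>x\<in>B. ennreal (- (q x * ln (q x))))"
      using B by (simp add: sum.reindex[OF \<psi>(1)] Q)
    also have "\<dots> = ennreal j" unfolding j_def using nonneg by (intro sum_ennreal) auto
    finally have J: "J_entropy ?V Q = ennreal j" .
    have j0: "j \<ge> 0" unfolding j_def using nonneg by (rule sum_nonneg)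
    have "ennreal c \<le> I_energy ?E Q + ennreal \<rho> * J_entropy ?V Q"
      using c(2) unfolding chi_def
      by (rule order_trans) (rule INF_lower, use setQ \<psi>(2) in auto)
    also have "\<dots> = ennreal (i + \<rho> * j)"
      unfolding I J using i0 j0 \<rho> by (simp add: ennreal_mult[symmetric] ennreal_plus[symmetric] del: ennreal_plus)
    finally have "c \<le> i + \<rho> * j" using i0 j0 \<rho> by (subst (asm) ennreal_le_iff) auto
    \<comment> \<open>With \<open>p\<close> in place of \<open>q\<close> the logarithm is free of
      the normalisation, so multiplying by \<open>N\<close> leaves a sum of local terms.\<close>
    also have "j \<le> (\<Sum>x\<in>B. - (q x * ln (pmf p x)))"
      unfolding j_def
    proof (rule gibbs_inequality[OF B(1)])
      show "sum (pmf p) B \<le> sum q B"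
        unfolding sumq using measure_measure_pmf_finite[OF B(1), of p] by (metis measure_pmf.prob_le_1)
      fix x assume "x \<in> B" "q x > 0"
      then show "pmf p x > 0" using h by (force simp: q_def)
    qed (auto simp: q0)
    finally have "c \<le> i + \<rho> * (\<Sum>x\<in>B. - (q x * ln (pmf p x)))" using \<rho> by simp
    then have "N * c \<le> N * (i + \<rho> * (\<Sum>x\<in>B. - (q x * ln (pmf p x))))"
      using N by (intro mult_left_mono) auto
    also have "\<dots> = (\<Sum>x\<in>B. real d * (h x)\<^sup>2) - 2 * (\<Sum>x\<in>B - {v}. h x * h (par x)) +
        \<rho> * (\<Sum>x\<in>B. - (real d * (h x)\<^sup>2 * ln (pmf p x)))"
    proof -
      have "(\<Sum>x\<in>B. - (q x * ln (pmf p x))) = (\<Sum>x\<in>B. - (real d * (h x)\<^sup>2 * ln (pmf p x))) / N"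
        by (simp add: q_def sum_divide_distrib)
      then show ?thesis using N by (simp add: i_def field_simps)
    qed
    finally show ?thesis
      by (simp add: N_def algebra_simps sum.distrib sum_subtractf sum_distrib_left sum_negf sum_distrib_right)
  qed
qed


section \<open>Comparison with the homogeneous tree\<close>

lemma finite_sum_le_infsum_ennreal:
  fixes f :: "'a \<Rightarrow> ennreal"
  assumes "finite F" "F \<subseteq> A"
  shows "sum f F \<le> infsum f A"
  using assms by (subst nonneg_infsum_complete) (auto intro: SUP_upper)

lemma finite_pmf_greater:
  assumes "\<delta> > 0"
  shows "finite {x. pmf p x > \<delta>}"
proof (rule ccontr)
  assume "infinite {x. pmf p x > \<delta>}"
  then obtain T where T: "finite T" "card T = Suc (nat \<lceil>1 / \<delta>\<rceil>)" "T \<subseteq> {x. pmf p x > \<delta>}"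
    using infinite_arbitrarily_large by blast
  have "1 / \<delta> < real (card T)" unfolding T(2) by linarith
  then have "1 < real (card T) * \<delta>" using assms by (simp add: field_simps)
  also have "\<dots> \<le> sum (pmf p) T" using T by (intro sum_bounded_below) auto
  also have "\<dots> \<le> 1"
    using measure_measure_pmf_finite[OF T(1), of p] by (metis measure_pmf.prob_le_1)
  finally show False by simp
qed

text \<open>The finite sums of \<open>pmf p\<close> over subsets of the support approach the total
  mass 1.\<close>

lemma le_of_finite_pmf_sums:
  assumes "0 \<le> c" and le: "\<And>F. finite F \<Longrightarrow> F \<subseteq> set_pmf p \<Longrightarrow> c * sum (pmf p) F \<le> b"
  shows "c \<le> b"
proof -
  have "(pmf p has_sum 1) (set_pmf p)"
    using infsetsum_pmf_eq_1[of p "set_pmf p"] pmf_abs_summable[of p "set_pmf p"]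
    by (metis abs_summable_equivalent abs_summable_summable has_sum_infsum infsetsum_infsum order_refl)
  then have "((\<lambda>x. c * pmf p x) has_sum c * 1) (set_pmf p)" by (rule has_sum_cmult_right)
  then have "infsum (\<lambda>x. c * pmf p x) (set_pmf p) = c" "(\<lambda>x. c * pmf p x) summable_on set_pmf p"
    by (auto simp: infsumI has_sum_imp_summable)
  moreover have "infsum (\<lambda>x. c * pmf p x) (set_pmf p) \<le> b"
    using calculation(2) le by (intro infsum_le_finite_sums) (auto simp: sum_distrib_left)
  ultimately show ?thesis by simp
qed

text \<open>Soft thresholding \<open>(g - \<epsilon>)\<^sup>+\<close> makes the support finite and, being a contraction,
  does not increase the energy of any edge.\<close>
lemma (in rooted_tree) truncated_lower_bound:
  fixes p :: "'a pmf"
  assumes d: "d \<ge> 2" and degree: "\<And>x. x \<in> V \<Longrightarrow> d \<le> graph_degree E x"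
    and \<rho>: "\<rho> > 0" and c: "0 \<le> c" "ennreal c \<le> chi (hom_tree_verts d) (hom_tree_edges d) \<rho>"
    and p: "set_pmf p \<subseteq> V"
    and I: "I_energy E p = ennreal i" "0 \<le> i" and J: "J_entropy V p = ennreal j" "0 \<le> j"
    and \<epsilon>: "\<epsilon> > 0" and F: "finite F" "F \<subseteq> V"
  shows "c * (\<Sum>x\<in>F. real (graph_degree E x) * (max (sqrt (pmf p x / graph_degree E x) - \<epsilon>) 0)\<^sup>2)
      \<le> i + \<rho> * j"
proof -
  define D where "D x = real (graph_degree E x)" for x
  define g where "g x = sqrt (pmf p x / D x)" for x
  define h where "h x = max (g x - \<epsilon>) 0" for x
  \<comment> \<open>The logarithm is that of \<open>p\<close> itself, not of the truncated mass, so
    that \<open>\<alpha>\<close> is the same for all subtrees.\<close>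
  define \<alpha> where "\<alpha> x = (h x)\<^sup>2 * (1 - \<rho> * ln (pmf p x) - c)" for x
  define A where "A = {x \<in> V. h x > 0}"
  have D: "D x \<ge> 1" if "x \<in> V" for x using degree[OF that] d by (simp add: D_def)
  have h0: "h x \<ge> 0" for x by (simp add: h_def)
  have hg: "h x \<le> g x" for x using \<epsilon> D by (auto simp: h_def g_def D_def)
  have Dg: "D x * (g x)\<^sup>2 = pmf p x" if "x \<in> V" for x using D[OF that] by (simp add: g_def)
  have Dh: "D x * (h x)\<^sup>2 \<le> pmf p x" if "x \<in> V" for x
    unfolding Dg[OF that, symmetric] using h0 hg D[OF that]
    by (intro mult_left_mono power_mono) auto
  have gp: "pmf p x > 0" if "h x > 0" for x
  proof (rule ccontr)
    assume "\<not> pmf p x > 0"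
    then have "g x = 0" by (simp add: g_def not_less pmf_nonneg order_antisym)
    then show False using that \<epsilon> by (simp add: h_def)
  qed
  \<comment> \<open>If \<open>h x > 0\<close> then \<open>g x > \<epsilon>\<close>, and all degrees
    are at least 1; only finitely many points carry such mass.\<close>
  have "A \<subseteq> {x. pmf p x > \<epsilon>\<^sup>2}"
  proof
    fix x assume x: "x \<in> A"
    then have "\<epsilon> < g x" "x \<in> V" by (auto simp: A_def h_def max_def split: if_splits)
    then have "\<epsilon>\<^sup>2 < (g x)\<^sup>2" using \<epsilon> by (intro power_strict_mono) auto
    also have "\<dots> \<le> D x * (g x)\<^sup>2" using D[OF \<open>x \<in> V\<close>] by (simp add: mult_le_cancel_right1)
    finally show "x \<in> {x. pmf p x > \<epsilon>\<^sup>2}" using Dg \<open>x \<in> V\<close> by simp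
  qed
  then have A: "finite A" "A \<subseteq> V"
    using finite_pmf_greater[of "\<epsilon>\<^sup>2" p] \<epsilon> finite_subset by (auto simp: A_def)
  have h_out: "h x = 0" if "x \<notin> A" for x
  proof (cases "x \<in> V")
    case False
    then have "pmf p x = 0" using p by (auto simp: set_pmf_iff)
    then show ?thesis using gp h0 by (metis less_irrefl order_le_less)
  qed (use that h0[of x] in \<open>auto simp: A_def\<close>)
  have nonneg: "0 \<le> (\<Sum>x\<in>B. real d * \<alpha> x - 2 * h x * h (par x)) + 2 * h v * h (par v)"
    if emb: "embeds (hom_tree_verts d) v B \<psi>" for v B \<psi>
  proof -
    have "0 \<le> (\<Sum>x\<in>B. real d * \<alpha> x) - 2 * (\<Sum>x\<in>B - {v}. h x * h (par x))"
      unfolding \<alpha>_def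
      by (rule hom_tree_lower_bound[where \<psi> = \<psi>]) (use d \<rho> c emb h0 gp in \<open>auto simp: embeds_def\<close>)
    moreover have "(\<Sum>x\<in>B. h x * h (par x)) = h v * h (par v) + (\<Sum>x\<in>B - {v}. h x * h (par x))"
      using emb by (intro sum.remove) (auto simp: embeds_def)
    ultimately show ?thesis by (simp add: sum_subtractf mult.assoc sum_distrib_left[symmetric])
  qed
  \<comment> \<open>\<open>n\<close> bounds the depths in \<open>A\<close>, so the descendants of
    \<open>r\<close> down to level \<open>Suc n\<close> include all of \<open>A\<close>.\<close>
  define n where "n = Max (insert 0 (dep ` A))"
  define T where "T = desc (Suc n) r"
  have "dep x \<le> n" if "x \<in> A" for x using A that by (auto simp: n_def)
  then have AT: "A \<subseteq> T" using A by (auto simp: T_def intro!: in_desc_root le_SucI)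
  have "0 \<le> (\<Sum>x\<in>T. D x * \<alpha> x - 2 * h x * h (par x)) + 2 * h r * h (par r)"
    unfolding T_def D_def by (rule tree_sum_nonneg[OF d degree nonneg])
  also have "(\<Sum>x\<in>T. D x * \<alpha> x - 2 * h x * h (par x)) = (\<Sum>x\<in>A. D x * \<alpha> x - 2 * h x * h (par x))"
    using AT h_out finite_desc[OF root(1)] unfolding T_def
    by (intro sum.mono_neutral_right) (auto simp: \<alpha>_def)
  also have "\<dots> = (\<Sum>x\<in>A. D x * \<alpha> x) - 2 * (\<Sum>x\<in>A. h x * h (par x))"
    by (simp add: sum_subtractf sum_distrib_left mult.assoc)
  \<comment> \<open>The term at \<open>r\<close>, with its unspecified \<open>par r\<close>, cancels
    against the correction term; if \<open>r\<close> is outside \<open>A\<close>, it is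
    zero.\<close>
  also have "(\<Sum>x\<in>A. h x * h (par x)) = h r * h (par r) + (\<Sum>x\<in>A - {r}. h x * h (par x))"
    using A h_out[of r] by (cases "r \<in> A") (auto intro: sum.remove)
  finally have "0 \<le> (\<Sum>x\<in>A. D x * \<alpha> x) - 2 * (\<Sum>x\<in>A - {r}. h x * h (par x))" by simp
  also have "(\<Sum>x\<in>A. D x * \<alpha> x) = (\<Sum>x\<in>A. D x * (h x)\<^sup>2)
      + \<rho> * (\<Sum>x\<in>A. D x * (h x)\<^sup>2 * - ln (pmf p x)) - c * (\<Sum>x\<in>A. D x * (h x)\<^sup>2)"
    by (simp add: \<alpha>_def sum_distrib_left sum.distrib[symmetric] sum_subtractf[symmetric] algebra_simps)
  finally have main: "c * (\<Sum>x\<in>A. D x * (h x)\<^sup>2) \<le>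
      ((\<Sum>x\<in>A. D x * (h x)\<^sup>2) - 2 * (\<Sum>x\<in>A - {r}. h x * h (par x)))
      + \<rho> * (\<Sum>x\<in>A. D x * (h x)\<^sup>2 * - ln (pmf p x))" by simp
  let ?W = "{x \<in> V - {r}. x \<in> A \<or> par x \<in> A}"
  have h_out': "\<forall>x\<in>V - A. h x = 0" using h_out by blast
  note ssd = sum_square_differences[OF A h_out']
  have energy: "(\<Sum>x\<in>A. D x * (h x)\<^sup>2) - 2 * (\<Sum>x\<in>A - {r}. h x * h (par x)) \<le> i"
  proof -
    have "ennreal (\<Sum>x\<in>?W. (h x - h (par x))\<^sup>2) = (\<Sum>x\<in>?W. ennreal ((h x - h (par x))\<^sup>2))"
      by (simp add: sum_ennreal)
    also have "\<dots> \<le> (\<Sum>x\<in>?W. ennreal ((g x - g (par x))\<^sup>2))"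
    proof (intro sum_mono ennreal_leI)
      fix x
      have "\<bar>h x - h (par x)\<bar> \<le> \<bar>g x - g (par x)\<bar>" by (auto simp: h_def max_def)
      then show "(h x - h (par x))\<^sup>2 \<le> (g x - g (par x))\<^sup>2" by (simp add: abs_le_square_iff)
    qed
    also have "\<dots> \<le> I_energy E p"
      unfolding I_energy_eq g_def D_def
      by (rule finite_sum_le_infsum_ennreal) (use ssd(1) in auto)
    finally show ?thesis using ssd(3) I by (simp add: D_def ennreal_le_iff)
  qed
  have ln: "ln (pmf p x) \<le> 0" for x
    using pmf_le_1[of p x] by (cases "pmf p x = 0") (auto simp: pmf_pos)
  have entropy: "(\<Sum>x\<in>A. D x * (h x)\<^sup>2 * - ln (pmf p x)) \<le> j"
  proof -
    have term_nonneg: "0 \<le> D x * (h x)\<^sup>2 * - ln (pmf p x)" for x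
      using ln[of x] by (intro mult_nonneg_nonneg) (auto simp: D_def)
    then have "ennreal (\<Sum>x\<in>A. D x * (h x)\<^sup>2 * - ln (pmf p x)) =
        (\<Sum>x\<in>A. ennreal (D x * (h x)\<^sup>2 * - ln (pmf p x)))"
      by (intro sum_ennreal[symmetric]) auto
    \<comment> \<open>Truncation only lowers the weight in front of \<open>- ln (pmf p x)\<close>,
      which is nonnegative.\<close>
    also have "\<dots> \<le> (\<Sum>x\<in>A. ennreal (pmf p x * - ln (pmf p x)))"
      using Dh A ln by (intro sum_mono ennreal_leI mult_right_mono) auto
    also have "\<dots> \<le> J_entropy V p"
      unfolding J_entropy_def using A finite_sum_le_infsum_ennreal[of A V "\<lambda>x. ennreal (- (pmf p x * ln (pmf p x)))"]
      by simp
    finally show ?thesis using J by (simp add: ennreal_le_iff)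
  qed
  have "c * (\<Sum>x\<in>F. D x * (h x)\<^sup>2) \<le> c * (\<Sum>x\<in>A. D x * (h x)\<^sup>2)"
  proof -
    have "(\<Sum>x\<in>F. D x * (h x)\<^sup>2) = (\<Sum>x\<in>F \<inter> A. D x * (h x)\<^sup>2)"
      using F h_out by (intro sum.mono_neutral_right) auto
    also have "\<dots> \<le> (\<Sum>x\<in>A. D x * (h x)\<^sup>2)"
      using A by (intro sum_mono2) (auto simp: D_def)
    finally show ?thesis using c by (intro mult_left_mono) auto
  qed
  also note main
  also have "((\<Sum>x\<in>A. D x * (h x)\<^sup>2) - 2 * (\<Sum>x\<in>A - {r}. h x * h (par x)))
      + \<rho> * (\<Sum>x\<in>A. D x * (h x)\<^sup>2 * - ln (pmf p x)) \<le> i + \<rho> * j"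
    using energy entropy \<rho> by (intro add_mono mult_left_mono) auto
  finally show ?thesis unfolding D_def h_def g_def .
qed

text \<open>Otherwise a real \<open>c\<close> lies strictly between the two values. In
  \<open>truncated_lower_bound\<close> for this \<open>c\<close>, first \<epsilon> tends to 0 with a
  finite set \<open>F\<close> fixed, then \<open>F\<close> exhausts the support of
  \<open>p\<close>.\<close>

theorem chi_hom_tree_le:
  assumes tree: "infinite_tree_with_degrees S V E" and S: "\<And>k. k \<in> S \<Longrightarrow> int d \<le> k"
    and d: "d \<ge> 2" and \<rho>: "\<rho> > 0"
  shows "chi (hom_tree_verts d) (hom_tree_edges d) \<rho> \<le> chi V E \<rho>"
proof -
  have "is_tree V E" and fin: "\<And>x. x \<in> V \<Longrightarrow> finite (neighbours E x)"
    and degree: "\<And>x. x \<in> V \<Longrightarrow> d \<le> graph_degree E x"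
    using tree S by (force simp: infinite_tree_with_degrees_def)+
  then obtain r par dep where "rooted_tree V E r par dep" using rooted_tree_of_tree by blast
  then interpret rooted_tree V E r par dep .
  show ?thesis
    unfolding chi_def[of V]
  proof (rule INF_greatest)
    fix p assume "p \<in> {p. set_pmf p \<subseteq> V}"
    then have p: "set_pmf p \<subseteq> V" by simp
    show "chi (hom_tree_verts d) (hom_tree_edges d) \<rho> \<le> I_energy E p + ennreal \<rho> * J_entropy V p"
    proof (rule ccontr)
      assume "\<not> ?thesis"
      then obtain b where b: "I_energy E p + ennreal \<rho> * J_entropy V p < b"
          "b < chi (hom_tree_verts d) (hom_tree_edges d) \<rho>"
        using dense by (metis not_le)
      then have "b \<noteq> \<top>" by auto
      then obtain c where c: "b = ennreal c" "0 \<le> c" by (cases b) auto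
      have "I_energy E p \<noteq> \<top>" "ennreal \<rho> * J_entropy V p \<noteq> \<top>" using b by auto
      then have "J_entropy V p \<noteq> \<top>" using \<rho> by (auto simp: ennreal_mult_eq_top_iff)
      obtain i where i: "I_energy E p = ennreal i" "0 \<le> i"
        using \<open>I_energy E p \<noteq> \<top>\<close> by (cases "I_energy E p") auto
      obtain j where j: "J_entropy V p = ennreal j" "0 \<le> j"
        using \<open>J_entropy V p \<noteq> \<top>\<close> by (cases "J_entropy V p") auto
      have "c \<le> i + \<rho> * j"
      proof (rule le_of_finite_pmf_sums[OF c(2)])
        fix F assume F: "finite F" "F \<subseteq> set_pmf p"
        let ?D = "\<lambda>x. real (graph_degree E x)"
        let ?s = "\<lambda>\<epsilon>. c * (\<Sum>x\<in>F. ?D x * (max (sqrt (pmf p x / ?D x) - \<epsilon>) 0)\<^sup>2)"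
        have "(?s \<longlongrightarrow> c * (\<Sum>x\<in>F. ?D x * (max (sqrt (pmf p x / ?D x) - 0) 0)\<^sup>2)) (at_right 0)"
          by (intro tendsto_intros)
        also have "(\<Sum>x\<in>F. ?D x * (max (sqrt (pmf p x / ?D x) - 0) 0)\<^sup>2) = sum (pmf p) F"
        proof (rule sum.cong[OF refl])
          fix x assume "x \<in> F"
          then have "?D x > 0" using degree[of x] d F p by fastforce
          then show "?D x * (max (sqrt (pmf p x / ?D x) - 0) 0)\<^sup>2 = pmf p x" by simp
        qed
        finally have lim: "(?s \<longlongrightarrow> c * sum (pmf p) F) (at_right 0)" .
        \<comment> \<open>The bound holds for every positive \<epsilon>; the witness 1 is an
          arbitrary right end of the interval.\<close>
        have "\<forall>\<^sub>F \<epsilon> in at_right 0. ?s \<epsilon> \<le> i + \<rho> * j"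
          unfolding eventually_at_right_field
          using truncated_lower_bound[OF d degree \<rho> c(2) _ p i j _ F(1)] F(2) p b c(1)
          by (intro exI[of _ 1]) auto
        then show "c * sum (pmf p) F \<le> i + \<rho> * j"
          by (rule tendsto_upperbound[OF lim]) simp
      qed
      moreover have "i + \<rho> * j < c"
        using b(1) \<rho> i j c by (simp add: ennreal_mult[symmetric] ennreal_plus[symmetric] ennreal_less_iff del: ennreal_plus)
      ultimately show False by simp
    qed
  qed
qed

theorem theorem1p4:
  fixes M :: "'w measure" and D :: "'w \<Rightarrow> int" and d_min :: nat and \<rho> :: real
  assumes "prob_space M"
    and "D \<in> measurable M (count_space UNIV)"
    and "int d_min \<in> discrete_supp M D"
    and "\<And>k. k \<in> discrete_supp M D \<Longrightarrow> int d_min \<le> k"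
    and "d_min \<ge> 2"
    and "\<rho> > 0"
    and "\<rho> \<ge> 1 / ((real d_min - 1) * ln (real d_min + 1))"
  shows "chi_tilde (discrete_supp M D) \<rho> = chi (hom_tree_verts d_min) (hom_tree_edges d_min) \<rho>"
proof (rule antisym)
  \<comment> \<open>Since \<open>d_min\<close> belongs to the support, the homogeneous tree is
    itself a competitor.\<close>
  have "infinite_tree_with_degrees (discrete_supp M D) (hom_tree_verts d_min) (hom_tree_edges d_min)"
    using hom_tree_homogeneous[OF assms(5)] assms(3) by (auto simp: infinite_tree_with_degrees_def)
  then show "chi_tilde (discrete_supp M D) \<rho> \<le> chi (hom_tree_verts d_min) (hom_tree_edges d_min) \<rho>"
    by (rule chi_tilde_le)
  show "chi (hom_tree_verts d_min) (hom_tree_edges d_min) \<rho> \<le> chi_tilde (discrete_supp M D) \<rho>"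
    unfolding chi_tilde_def using chi_hom_tree_le[OF _ assms(4-6)] by (intro INF_greatest) auto
qed

end
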